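(* Let $\alpha:=(9+\sqrt{105})/2$ and $d_v^*:=\log\alpha/\log 16\ (\approx .8166)$. Then $$\max_{f\in\mathcal{T}_v}\ \max_{y\in\mathbb{R}}\ \dim_H L_f(y)=d_v^* .$$
   Context: $\phi(x)=\operatorname{dist}(x,\mathbb{Z})$ is the distance from $x\in\mathbb{R}$ to the nearest integer. $\mathcal{T}_v$ is the class of all functions $f:[0,1]\to\mathbb{R}$ of the form $$f(x)=\sum_{n=0}^\infty\frac{\omega_n(x)}{2^n}\phi(2^n x),\qquad 0\le x\le 1,$$ where for each $n\ge 0$ the function $\omega_n$ takes values in $\{-1,1\}$ and is constant on each interval $[j/2^n,(j+1)/2^n)$, $j=0,1,\dots,2^n-1$ (the value $\omega_n(1)$ is immaterial since $\phi(2^n)=0$). All such $f$ are continuous. For $y\in\mathbb{R}$, $L_f(y)=\{x\in[0,1]: f(x)=y\}$. $\dim_H$ denotes Hausdorff dimension (with the convention $\dim_H\emptyset=0$). *)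

theory Defs
  imports "HOL-Analysis.Analysis"
begin

definition phi :: "real \<Rightarrow> real" where
  "phi x = infdist x \<int>"

(* Functions on [0,1] are represented by total functions on the reals whose
   values outside [0,1] are unconstrained. *)
definition T_v :: "(real \<Rightarrow> real) set" where
  "T_v = {f. \<exists>\<omega> :: nat \<Rightarrow> real \<Rightarrow> real.
      (\<forall>n. \<forall>x\<in>{0..1}. \<omega> n x \<in> {-1, 1}) \<and>
      (\<forall>n. \<forall>j<2 ^ n. \<omega> n constant_on {real j / 2 ^ n ..< (real j + 1) / 2 ^ n}) \<and>
      (\<forall>x\<in>{0..1}. (\<lambda>n. \<omega> n x / 2 ^ n * phi (2 ^ n * x)) sums f x)}"

definition level_set :: "(real \<Rightarrow> real) \<Rightarrow> real \<Rightarrow> real set" where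
  "level_set f y = {x \<in> {0..1}. f x = y}"

(* The s-th power of the diameter, with the usual conventions that the empty set
   contributes 0 for every s and that a nonempty set contributes 1 for s = 0
   (in contrast to 0 powr 0 = 0). *)
definition diam_powr :: "real \<Rightarrow> 'a::metric_space set \<Rightarrow> ennreal" where
  "diam_powr s U = (if U = {} then 0 else if s = 0 then 1 else ennreal (diameter U powr s))"

(* Boundedness is required because diameter has no meaningful value on unbounded sets.
   Finite covers are included, since members of the sequence may be empty. *)
definition hausdorff_premeasure :: "real \<Rightarrow> real \<Rightarrow> 'a::metric_space set \<Rightarrow> ennreal" where
  "hausdorff_premeasure \<delta> s A =
     (INF U \<in> {U :: nat \<Rightarrow> 'a set. A \<subseteq> (\<Union>i. U i) \<and> (\<forall>i. bounded (U i) \<and> diameter (U i) \<le> \<delta>)}.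
        (\<Sum>i. diam_powr s (U i)))"

definition hausdorff_measure :: "real \<Rightarrow> 'a::metric_space set \<Rightarrow> ennreal" where
  "hausdorff_measure s A = (SUP \<delta>\<in>{0<..}. hausdorff_premeasure \<delta> s A)"

(* The infimum is infinite if no s qualifies; the empty set gets dimension 0. *)
definition hausdorff_dim :: "'a::metric_space set \<Rightarrow> ereal" where
  "hausdorff_dim A = (INF s \<in> {s. 0 \<le> s \<and> hausdorff_measure s A = 0}. ereal s)"

definition d_v_star :: real where
  "d_v_star = ln ((9 + sqrt 105) / 2) / ln 16"

end

theory Submission
  imports Defs
begin

text \<open>
  Fix a level \<open>y\<close> and a function \<open>f\<close> of the class, and let \<open>f_n\<close> be the sum of its first \<open>n\<close>
  terms. On a dyadic interval of length \<open>2^-n\<close> the function \<open>2^n (f_n - y)\<close> is affine with an integer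
  slope per cell length. Call this affine piece the chord of the cell. The next term adds a tent
  to the chord, upwards or downwards, so that a chord of slope \<open>s\<close> is replaced by chords of slopes
  \<open>s + 1\<close> and \<open>s - 1\<close>, in an order of our choice. How \<open>f\<close> can meet the level inside the cell depends, by
  symmetry, only on \<open>n = |s|\<close> and on the height \<open>e\<close> of the level over the lower end of the chord. For
  \<open>n \<ge> 1\<close> the state \<open>(n, e)\<close> has as its two children either \<open>(n - 1, 2e)\<close> and \<open>(n + 1, 2e - n + 1)\<close>,
  or \<open>(n + 1, 2e)\<close> and \<open>(n - 1, 2e - n - 1)\<close>; for \<open>n = 0\<close> it has two copies of \<open>(1, 2e)\<close> or of
  \<open>(1, 2e + 1)\<close>. The dimension of level sets is thus governed by the largest growth rate of the number
  of states that still reach the level.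
  
  Let \<open>alpha = (9 + sqrt 105) / 2\<close>, the positive root of \<open>alpha = 9 + 6 / alpha\<close>, and \<open>mu = sqrt alpha\<close>.
  The claimed dimension satisfies \<open>4 powr d = mu\<close> (\<open>two_powr_dim\<close>), so growth by \<open>mu\<close> in every two
  generations is what has to be shown to be possible and optimal.
  
  Upper bound: there is an explicit nonnegative potential \<open>pot n e\<close> whose sum over the two children
  never exceeds the potential of the parent, times \<open>mu\<close> if \<open>n\<close> is odd (\<open>cell_pot_children\<close>). Slopes have the
  parity of the generation, so after \<open>2k\<close> generations the total potential is at most \<open>mu^k\<close> times the
  initial one (\<open>total_weight\<close>). A cell that meets the level has potential at least \<open>17/100\<close>: outside of the
  region where this holds, the distance of the level from the chord doubles in each generation, while it must
  stay bounded along the cells around a point of the level set (\<open>weight_ge\<close>). Hence the level set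
  is covered by a constant times \<open>mu^k\<close> cells of length \<open>4^-k\<close>, which bounds its dimension.
  
  Lower bound: take the level \<open>-8/17\<close> and bend every chord towards it. The fractional parts of the
  heights run through \<open>8/17, 16/17, 15/17, 13/17, ...\<close>, that is, up to sign through a cycle of length
  four, and every cell either leaves the level for good or is in one of nine states (\<open>orbit\<close>). On these
  states the potential inequality is an equality (\<open>orbit_children\<close>), so the potential divided by the
  growth is an additive mass on dyadic cells which decays like \<open>(2^-n) powr d\<close>. The mass distribution
  principle (\<open>mass_distribution\<close>) turns it into a lower bound for the dimension of its support, which
  consists of points where the function has the value \<open>-8/17\<close>.
\<close>

section \<open>The growth rate\<close>

text \<open>
  The growth factor over two generations; its square is the number \<open>alpha\<close> of the dimension formula.
\<close>

definition mu :: real where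
  "mu = sqrt ((9 + sqrt 105) / 2)"

lemma mu_pos: "mu > 0"
  unfolding mu_def by (simp add: add_pos_nonneg)

lemma mu_power2: "mu ^ 2 = (9 + sqrt 105) / 2"
  unfolding mu_def by (simp add: add_nonneg_nonneg)

text \<open>
  The equation \<open>alpha = 9 + 6 / alpha\<close> for \<open>alpha = mu^2\<close>, divided by \<open>mu\<close>. In this form it is the
  balance of potentials at the height \<open>4/17\<close> in \<open>pot1_step\<close>.
\<close>

lemma mu_cubic: "9 / mu + 6 / mu ^ 2 / mu = mu"
proof -
  have "(mu ^ 2) ^ 2 = 9 * mu ^ 2 + 6"
    unfolding mu_power2 by (simp add: power2_eq_square field_simps)
  then have "mu * mu ^ 3 = 9 * mu ^ 2 + 6" by (simp add: power2_eq_square power3_eq_cube)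
  then show ?thesis using mu_pos
    by (simp add: field_simps power2_eq_square power3_eq_cube)
qed

lemma mu_bounds: "3102 / 1000 < mu" "mu < 31022 / 10000"
proof -
  have "10246 / 1000 < sqrt 105"
    by (rule real_less_rsqrt) (simp add: power2_eq_square)
  moreover have "sqrt 105 < 10247 / 1000"
    by (rule real_less_lsqrt) (simp_all add: power2_eq_square)
  ultimately have "(3102 / 1000) ^ 2 < mu ^ 2" "mu ^ 2 < (31022 / 10000) ^ 2"
    unfolding mu_power2 by (auto simp: power2_eq_square)
  then show "3102 / 1000 < mu" "mu < 31022 / 10000"
    using mu_pos by (meson less_imp_le power_less_imp_less_base zero_le_divide_iff zero_le_numeral)+
qed

lemma inverse_mu_bounds: "3223 / 10000 < 1 / mu" "1 / mu < 3224 / 10000"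
  using mu_bounds mu_pos by (auto simp: field_simps)

lemma mu_power2_bounds: "6 < mu ^ 2" "623 / 1000 < 6 / mu ^ 2" "6 / mu ^ 2 < 624 / 1000"
proof -
  have "(3102 / 1000) ^ 2 < mu ^ 2" "mu ^ 2 < (31022 / 10000) ^ 2"
    using mu_bounds by (auto intro!: power_strict_mono)
  then show "6 < mu ^ 2" "623 / 1000 < 6 / mu ^ 2" "6 / mu ^ 2 < 624 / 1000"
    by (auto simp: field_simps power2_eq_square)
qed

lemmas mu_numeric = mu_pos mu_bounds inverse_mu_bounds mu_power2_bounds

lemma inverse_two_power_powr: "(1 / 2 ^ n :: real) powr s = 2 powr (- (real n * s))"
  by (simp add: powr_minus_divide powr_realpow[symmetric] powr_divide powr_powr)

lemma d_v_star_eq: "d_v_star = ln mu / (2 * ln 2)"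
proof -
  have "ln 16 = ln ((2 :: real) ^ 4)" by simp
  also have "\<dots> = 4 * ln 2" by (subst ln_realpow) auto
  finally have "ln (16 :: real) = 4 * ln 2" .
  moreover have "ln (mu ^ 2) = 2 * ln mu" using mu_pos by (subst ln_realpow) auto
  ultimately show ?thesis
    unfolding d_v_star_def mu_power2[symmetric] by simp
qed

lemma two_powr_dim: "2 powr (2 * d_v_star) = mu"
proof -
  have "2 * d_v_star * ln 2 = ln mu" by (simp add: d_v_star_eq)
  then show ?thesis using mu_pos by (simp add: powr_def)
qed

lemma d_v_star_pos: "0 < d_v_star"
  unfolding d_v_star_eq using mu_bounds by (intro divide_pos_pos ln_gt_zero) auto

section \<open>A potential for the position of the level relative to a chord\<close>

text \<open>
  The potential of a chord of slope \<open>1\<close>. Swapping the two ends of the chord replaces \<open>e\<close> by \<open>1 - e\<close>, so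
  only the distance \<open>d\<close> to the nearer end counts; negative \<open>d\<close> means a level outside the range of the chord.
  
  The extremal configuration visits the distances \<open>1/17\<close>, \<open>4/17\<close> and \<open>-4/17\<close>. There the values \<open>3/mu\<close>,
  \<open>1\<close> and \<open>6/mu^2\<close> are forced, up to a common factor, by equality in all inequalities. Elsewhere there is
  some freedom, and most other values are rational numbers rounded up. Below \<open>-1/3\<close> no tent series can bring
  the graph back to the level. The number \<open>11/48 = (1 - 1/12) / 4\<close> is the least \<open>d\<close> for which a
  descendant of slope \<open>3\<close> at height \<open>4d - 1 \<ge> -1/12\<close> counts; \<open>11/192\<close> and \<open>11/768\<close> are its preimages under the
  passage \<open>d \<mapsto> 4d\<close> to grandchildren, which needs finer values close to \<open>0\<close>.
\<close>

definition pot1 :: "real \<Rightarrow> real" where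
  "pot1 e = (let d = min e (1 - e) in
     if d < - 1 / 3 then 0
     else if d \<le> - 11 / 48 then 6 / mu ^ 2
     else if d < - 1 / 12 then 645 / 1000
     else if d \<le> - 11 / 192 then 853 / 1000
     else if d < 11 / 768 then 921 / 1000
     else if d < 11 / 192 then 936 / 1000
     else if d < 11 / 48 then 3 / mu
     else if d \<le> 1 / 3 then 1
     else 3 / mu)"

text \<open>
  For a level just outside the chord the only surviving grandchild has slope \<open>1\<close>, and this dictates the
  value; it is tight at \<open>-1/17\<close>. The other values are generous.
\<close>

definition pot3 :: "real \<Rightarrow> real" where
  "pot3 e = (let d = min e (3 - e) in
     if d < - 1 / 12 then 0
     else if d < 0 then pot1 (4 * d) / mu
     else if d \<le> 1 / 12 then 1 / mu
     else 1 / 2)"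

text \<open>
  The values for slopes \<open>0\<close> and \<open>2\<close> are those of the better pair of children, so that the corresponding
  inequalities hold by definition. For slopes from \<open>4\<close> on a crude bound is enough: a cell can keep
  both children only if \<open>e\<close> is close to \<open>(n - 1) / 2\<close> or \<open>(n + 1) / 2\<close>, and then the level is close to
  an end of the chord of each child. The reduced value \<open>17/100\<close> near the ends pays for this.
\<close>

definition pot :: "nat \<Rightarrow> real \<Rightarrow> real" where
  "pot n e = (let d = min e (real n - e) in
     if n = 0 then 2 * pot1 (2 * \<bar>e\<bar>)
     else if n = 1 then pot1 e
     else if n = 2 then pot1 (2 * d) + pot3 (2 * d - 1)
     else if n = 3 then pot3 e
     else if d < - 1 / 12 then 0
     else if odd n \<and> d \<le> 1 / 12 then 17 / 100
     else 1 / 2)"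

lemma pot1_sym: "pot1 (1 - e) = pot1 e"
  by (simp add: pot1_def min.commute)

lemma pot3_sym: "pot3 (3 - e) = pot3 e"
  by (simp add: pot3_def min.commute)

lemma pot_sym: "pot n (real n - e) = pot n e"
  using pot1_sym[of e] pot3_sym[of e] by (simp add: pot_def min.commute Let_def)

lemma pot1_eq_0: "e < - 1 / 3 \<or> 4 / 3 < e \<Longrightarrow> pot1 e = 0"
  by (auto simp: pot1_def Let_def)

text \<open>
  All rows of the table at once, with the two irrational entries replaced by numerical bounds.
\<close>

lemma
  shows pot1_bounds: "0 \<le> pot1 e" "pot1 e \<le> 1"
    and pot1_ge: "- 1 / 3 \<le> e \<Longrightarrow> e \<le> 4 / 3 \<Longrightarrow> 623 / 1000 < pot1 e"
    and pot1_le_3_over_mu: "e < 11 / 48 \<Longrightarrow> pot1 e \<le> 3 / mu"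
    and pot1_le_936: "e < 11 / 192 \<Longrightarrow> pot1 e \<le> 936 / 1000"
    and pot1_le_921: "e < 11 / 768 \<Longrightarrow> pot1 e \<le> 921 / 1000"
    and pot1_le_853: "e \<le> - 11 / 192 \<Longrightarrow> pot1 e \<le> 853 / 1000"
    and pot1_le_645: "e < - 1 / 12 \<Longrightarrow> pot1 e \<le> 645 / 1000"
    and pot1_le_6_over_mu2: "e \<le> - 11 / 48 \<Longrightarrow> pot1 e \<le> 6 / mu ^ 2"
proof -
  define a b where "a = 6 / mu ^ 2" and "b = 3 / mu"
  have ab: "623 / 1000 < a" "a < 624 / 1000" "966 / 1000 < b" "b < 968 / 1000"
    using mu_numeric by (auto simp: a_def b_def)
  have less: "min e (1 - e) < x" if "e < x" for x using that by auto
  have le: "min e (1 - e) \<le> x" if "e \<le> x" for x using that by auto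
  note defs = pot1_def Let_def a_def[symmetric] b_def[symmetric]
  show "0 \<le> pot1 e" "pot1 e \<le> 1"
    unfolding defs using ab by simp_all
  show "623 / 1000 < pot1 e" if "- 1 / 3 \<le> e" "e \<le> 4 / 3"
    unfolding defs using ab that min_less_iff_disj[of e "1 - e" "- 1 / 3"] by simp
  show "pot1 e \<le> 3 / mu" if "e < 11 / 48"
    unfolding defs using ab less[OF that] by simp
  show "pot1 e \<le> 936 / 1000" if "e < 11 / 192"
    unfolding defs using ab less[OF that] by simp
  show "pot1 e \<le> 921 / 1000" if "e < 11 / 768"
    unfolding defs using ab less[OF that] by simp
  show "pot1 e \<le> 853 / 1000" if "e \<le> - 11 / 192"
    unfolding defs using ab le[OF that] by simp
  show "pot1 e \<le> 645 / 1000" if "e < - 1 / 12"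
    unfolding defs using ab less[OF that] by simp
  show "pot1 e \<le> 6 / mu ^ 2" if "e \<le> - 11 / 48"
    unfolding defs using ab le[OF that] by simp
qed

lemma pot1_minus_le:
  assumes "0 \<le> e"
  shows "pot1 (- e) \<le> pot1 e"
proof (cases "e \<le> 1 / 3")
  case True
  then show ?thesis using assms mu_numeric by (auto simp: pot1_def Let_def min_def)
next
  case False
  then show ?thesis using pot1_eq_0[of "- e"] pot1_bounds(1)[of e] by auto
qed

lemma pot3_eq_0: "e < - 1 / 12 \<or> 37 / 12 < e \<Longrightarrow> pot3 e = 0"
  by (auto simp: pot3_def Let_def)

lemma pot3_neg: "- 1 / 12 \<le> e \<Longrightarrow> e < 0 \<Longrightarrow> pot3 e = pot1 (4 * e) / mu"
  by (auto simp: pot3_def Let_def)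

lemma pot3_nonneg: "0 \<le> pot3 e"
  using mu_numeric pot1_bounds(1)[of "4 * e"]  pot1_bounds(1)[of "4 * (3 - e)"]
  by (auto simp: pot3_def Let_def min_def)

lemma pot3_edge: "e \<le> 1 / 12 \<Longrightarrow> pot3 e \<le> 1 / mu"
  using mu_numeric pot1_bounds(2)[of "4 * e"]
  by (auto simp: pot3_def Let_def min_def divide_simps)

lemma pot3_le: "pot3 e \<le> 1 / 2"
proof (cases "e \<le> 1 / 12 \<or> 3 - e \<le> 1 / 12")
  case True
  then show ?thesis using pot3_edge[of e] pot3_edge[of "3 - e"] pot3_sym[of e] mu_numeric by auto
next
  case False
  then show ?thesis by (auto simp: pot3_def Let_def min_def)
qed

lemma pot3_ge: assumes "- 1 / 12 \<le> e" "e \<le> 37 / 12" shows "17 / 100 \<le> pot3 e"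
proof -
  have *: "17 / 100 \<le> pot1 (4 * d) / mu" if "- 1 / 12 \<le> d" "d < 0" for d
    using pot1_ge[of "4 * d"] mu_numeric that by (auto simp: field_simps)
  show ?thesis using assms mu_numeric *[of e] *[of "3 - e"]
    by (auto simp: pot3_def Let_def min_def)
qed

lemma pot_simps:
  "pot 0 e = 2 * pot1 (2 * \<bar>e\<bar>)"
  "pot 1 e = pot1 e"
  "pot (Suc 0) e = pot1 e"
  "e \<le> 1 \<Longrightarrow> pot 2 e = pot1 (2 * e) + pot3 (2 * e - 1)"
  "pot 3 e = pot3 e"
  by (auto simp: pot_def Let_def min_def)

lemma pot_large:
  assumes "n \<ge> 4"
  shows "pot n e \<le> 1 / 2" "e < - 1 / 12 \<or> real n + 1 / 12 < e \<Longrightarrow> pot n e = 0"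
    "odd n \<Longrightarrow> e \<le> 1 / 12 \<or> real n - 1 / 12 \<le> e \<Longrightarrow> pot n e \<le> 17 / 100"
    "- 1 / 12 \<le> e \<Longrightarrow> e \<le> real n + 1 / 12 \<Longrightarrow> 17 / 100 \<le> pot n e"
  using assms by (auto simp: pot_def Let_def)

lemma pot_nonneg: "0 \<le> pot n e"
  using pot1_bounds(1) pot3_nonneg by (auto simp: pot_def Let_def intro!: add_nonneg_nonneg)

text \<open>
  The heart of the upper bound. A level in the lower half of a chord of slope \<open>1\<close> has the children
  \<open>(0, 2d)\<close> and \<open>(2, 2d)\<close>; their potentials are, by definition, the three terms on the left. The
  inequality is checked on each row of the table. There is equality at \<open>1/17\<close> and \<open>-4/17\<close>, by the choice
  of the values, and also at \<open>4/17\<close>: for \<open>d\<close> between \<open>11/48\<close> and \<open>1/3\<close> and with \<open>c = 1 - 4d\<close> the left side is \<open>3 * pot1 c + pot3 (- c)\<close>, which can be as large as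
  \<open>9 / mu + 6 / mu^2 / mu = mu\<close>.
\<close>

lemma pot1_step:
  assumes "d \<le> 1 / 2"
  shows "2 * pot1 (4 * \<bar>d\<bar>) + pot1 (4 * d) + pot3 (4 * d - 1) \<le> mu * pot1 d"
proof -
  have far: "pot3 (4 * d - 1) = 0" if "d < 11 / 48"
    using that by (intro pot3_eq_0) auto
  have mu3: "mu * (3 / mu) = 3" "mu * (6 / mu ^ 2) = 2 * (3 / mu)"
    using mu_pos by (auto simp: power2_eq_square)
  consider (a) "d < - 1 / 3" | (b) "- 1 / 3 \<le> d" "d \<le> - 11 / 48" | (c) "- 11 / 48 < d" "d < - 1 / 12"
    | (d) "- 1 / 12 \<le> d" "d \<le> - 11 / 192" | (e) "- 11 / 192 < d" "d < 0"
    | (f) "0 \<le> d" "d < 11 / 768" | (g) "11 / 768 \<le> d" "d < 11 / 192"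
    | (h) "11 / 192 \<le> d" "d < 11 / 48" | (i) "11 / 48 \<le> d" "d \<le> 1 / 3" | (j) "1 / 3 < d"
    by linarith
  then show ?thesis
  proof cases
    case a
    then show ?thesis using far pot1_eq_0[of "4 * \<bar>d\<bar>"] pot1_eq_0[of "4 * d"] pot1_eq_0[of d]
      by auto
  next
    case b
    then have "pot1 d = 6 / mu ^ 2" "pot1 (4 * d) = 0" "pot1 (4 * \<bar>d\<bar>) \<le> 3 / mu"
      using pot1_eq_0[of "4 * d"] pot1_le_3_over_mu[of "1 - 4 * \<bar>d\<bar>"] pot1_sym[of "4 * \<bar>d\<bar>"]
      by (auto simp: pot1_def Let_def)
    then show ?thesis using far b mu3 by auto
  next
    case c
    then have "pot1 d = 645 / 1000" "pot1 (4 * d) = 0" "pot3 (4 * d - 1) = 0"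
      using far pot1_eq_0[of "4 * d"] by (auto simp: pot1_def Let_def)
    moreover from this(1) have "mu * pot1 d = 645 / 1000 * mu" by simp
    ultimately show ?thesis using pot1_bounds(2)[of "4 * \<bar>d\<bar>"] mu_bounds(1) by linarith
  next
    case d
    then have "pot1 d = 853 / 1000" "pot1 (4 * d) \<le> 645 / 1000"
      using pot1_le_645[of "4 * d"] by (auto simp: pot1_def Let_def)
    moreover from this(1) have "mu * pot1 d = 853 / 1000 * mu" by simp
    ultimately show ?thesis using far d pot1_bounds(2)[of "4 * \<bar>d\<bar>"] mu_bounds(1) by linarith
  next
    case e
    then have "pot1 d = 921 / 1000" "pot1 (4 * d) \<le> 921 / 1000" "pot1 (4 * \<bar>d\<bar>) \<le> 3 / mu"
      using pot1_le_921[of "4 * d"] pot1_le_3_over_mu[of "4 * \<bar>d\<bar>"] by (auto simp: pot1_def Let_def)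
    moreover from this(1) have "mu * pot1 d = 921 / 1000 * mu" by simp
    moreover have "pot3 (4 * d - 1) = 0" using far e by auto
    ultimately show ?thesis using mu_numeric by linarith
  next
    case f
    then have "pot1 d = 921 / 1000" "pot1 (4 * d) \<le> 936 / 1000"
      using pot1_le_936[of "4 * d"] by (auto simp: pot1_def Let_def)
    moreover from this(1) have "mu * pot1 d = 921 / 1000 * mu" by simp
    moreover have "pot3 (4 * d - 1) = 0" "pot1 (4 * \<bar>d\<bar>) = pot1 (4 * d)" using far f by auto
    ultimately show ?thesis using mu_numeric by linarith
  next
    case g
    then have "pot1 d = 936 / 1000" "pot1 (4 * d) \<le> 3 / mu"
      using pot1_le_3_over_mu[of "4 * d"] by (auto simp: pot1_def Let_def)
    moreover from this(1) have "mu * pot1 d = 936 / 1000 * mu" by simp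
    moreover have "pot3 (4 * d - 1) = 0" "pot1 (4 * \<bar>d\<bar>) = pot1 (4 * d)" using far g by auto
    ultimately show ?thesis using mu_numeric by linarith
  next
    case h
    then have "pot1 d = 3 / mu"
      by (auto simp: pot1_def Let_def)
    then show ?thesis using far h mu3 pot1_bounds(2)[of "4 * d"] by auto
  next
    case i
    define c where "c = 1 - 4 * d"
    have c: "- 1 / 3 \<le> c" "c \<le> 1 / 12" "pot1 (4 * d) = pot1 c" "4 * d - 1 = - c"
      using i pot1_sym[of "4 * d"] by (auto simp: c_def)
    have "pot1 d = 1" using i by (auto simp: pot1_def Let_def)
    have "3 * pot1 c + pot3 (- c) \<le> mu"
    proof -
      have div: "x / mu \<le> y * (1 / mu)" if "x \<le> y" for x y :: real
        using that mu_pos by (simp add: divide_right_mono)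
      consider "c < - 1 / 12" | "- 1 / 12 \<le> c" "c \<le> 0" | "0 < c" "c < 11 / 768"
        | "11 / 768 \<le> c" "c < 11 / 192" | "11 / 192 \<le> c"
        by linarith
      then show ?thesis
      proof cases
        case 1
        then show ?thesis using pot1_le_645[of c] pot3_le[of "- c"] mu_numeric by auto
      next
        case 2
        then show ?thesis using pot1_le_921[of c] pot3_edge[of "- c"] mu_numeric by auto
      next
        case 3
        then show ?thesis
          using pot1_le_921[of c] pot3_neg[of "- c"] div[OF pot1_le_921[of "- 4 * c"]] mu_numeric c by auto
      next
        case 4
        then show ?thesis
          using pot1_le_936[of c] pot3_neg[of "- c"] div[OF pot1_le_853[of "- 4 * c"]] mu_numeric c by auto
      next
        \<comment> \<open>The row of \<open>c = 1/17\<close>, where nothing weaker than the equation \<open>mu_cubic\<close> would do.\<close>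
        case 5
        then show ?thesis
          using pot1_le_3_over_mu[of c] pot3_neg[of "- c"] div[OF pot1_le_6_over_mu2[of "- 4 * c"]]
            mu_cubic c by auto
      qed
    qed
    then show ?thesis using i c \<open>pot1 d = 1\<close> by auto
  next
    case j
    then have "pot1 d = 3 / mu" "pot1 (4 * d) = 0"
      using assms pot1_eq_0[of "4 * d"] by (auto simp: pot1_def Let_def)
    then show ?thesis using j mu3 pot3_le[of "4 * d - 1"] by auto
  qed
qed

text \<open>
  The growth by \<open>mu\<close> in two generations is charged to the odd slopes alone; this keeps square roots of
  \<open>mu\<close> out of the potential.
\<close>

definition rate :: "nat \<Rightarrow> real" where
  "rate n = (if even n then 1 else mu)"

text \<open>
  The tent bends the chord towards a level in its lower half. Both children can then meet the level.
\<close>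

lemma pot_split_le:
  assumes "n \<ge> 1" "e \<le> real n / 2"
  shows "pot (n - 1) (2 * e) + pot (n + 1) (2 * e - real n + 1) \<le> rate n * pot n e"
proof -
  consider "n = 1" | "n = 2" | "n = 3" | "n \<ge> 4" using assms by linarith
  then show ?thesis
  proof cases
    case 1
    then show ?thesis using assms pot1_step[of e]
      by (simp add: rate_def pot_simps numeral_2_eq_2[symmetric] abs_mult)
  next
    case 2
    then show ?thesis using assms by (simp add: rate_def pot_simps)
  next
    case 3
    consider "e < - 1 / 12" | "- 1 / 12 \<le> e" "e < 0" | "0 \<le> e" "e \<le> 1 / 12" | "1 / 12 < e" "e < 23 / 24"
      | "23 / 24 \<le> e" by linarith
    then have "pot 2 (2 * e) + pot 4 (2 * e - 2) \<le> mu * pot3 e"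
    proof cases
      case 1
      then show ?thesis using pot_large[of 4 "2 * e - 2"] pot1_eq_0[of "4 * e"]
          pot3_eq_0[of "4 * e - 1"] pot3_eq_0[of e] by (auto simp: pot_simps)
    next
      case 2
      then show ?thesis using pot_large[of 4 "2 * e - 2"]
          pot3_eq_0[of "4 * e - 1"] pot3_neg[of e] mu_pos by (auto simp: pot_simps)
    next
      case 3
      then show ?thesis using pot_large[of 4 "2 * e - 2"] pot1_bounds(2)[of "4 * e"]
          pot3_eq_0[of "4 * e - 1"] mu_pos by (auto simp: pot_simps pot3_def[of e])
    next
      case 4
      have "pot 2 (2 * e) \<le> 3 / 2"
      proof (cases "2 * e \<le> 1")
        case True
        then show ?thesis using pot1_bounds(2)[of "4 * e"] pot3_le[of "4 * e - 1"] by (simp add: pot_simps)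
      next
        case False
        then show ?thesis using pot1_bounds(2)[of "2 * (2 - 2 * e)"] pot3_le[of "2 * (2 - 2 * e) - 1"]
            pot_sym[of 2 "2 * e"] pot_simps(4)[of "2 - 2 * e"] by simp
      qed
      then show ?thesis using 4 pot_large[of 4 "2 * e - 2"] mu_numeric by (auto simp: pot3_def[of e])
    next
      case 5
      have "pot 2 (2 * e) \<le> 1"
        using 5 pot1_bounds(2)[of "2 * (2 - 2 * e)"] pot3_eq_0[of "2 * (2 - 2 * e) - 1"]
            pot_sym[of 2 "2 * e"] pot_simps(4)[of "2 - 2 * e"] by simp
      then show ?thesis using 5 assms \<open>n = 3\<close> pot_large(1)[of 4 "2 * e - 2"] mu_numeric
        by (auto simp: pot3_def[of e])
    qed
    then show ?thesis using 3 by (simp add: rate_def pot_simps)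
  next
    case 4
    let ?A = "pot (n - 1) (2 * e)" and ?B = "pot (n + 1) (2 * e - real n + 1)"
    have A: "?A \<le> 1 / 2"
      using 4 pot3_le[of "2 * e"] pot_large(1)[of "n - 1" "2 * e"] by (cases "n = 4") (auto simp: pot_simps)
    have B: "?B \<le> 1 / 2" using 4 by (intro pot_large) auto
    show ?thesis
    proof (cases "e < - 1 / 12")
      case True
      then have "?A = 0"
        using 4 pot3_eq_0[of "2 * e"] pot_large(2)[of "n - 1" "2 * e"] by (cases "n = 4") (auto simp: pot_simps)
      moreover have "?B = 0" using 4 True by (intro pot_large) auto
      ultimately show ?thesis using pot_nonneg[of n e] mu_pos by (simp add: rate_def)
    next
      case alive: False
      have mid: "?B = 0" if "2 * e < real n - 13 / 12"
        using 4 that by (intro pot_large) auto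
      show ?thesis
      proof (cases "odd n")
        case True
        then show ?thesis
          using alive mid A B 4 assms mu_numeric by (auto simp: rate_def pot_def[of n] Let_def)
      next
        case False
        have "?A + ?B \<le> 1 / 2"
        proof (cases "2 * e < real n - 13 / 12 \<or> real n - 11 / 12 < 2 * e")
          case True
          have "?A = 0" if "real n - 11 / 12 < 2 * e"
            using 4 that pot3_eq_0[of "2 * e"] pot_large(2)[of "n - 1" "2 * e"]
            by (cases "n = 4") (auto simp: pot_simps of_nat_diff)
          then show ?thesis using True mid A B by auto
        next
          \<comment> \<open>Both children may survive, but each sees the level within \<open>1/12\<close> of an end of its chord.\<close>
          case False': False
          have "?B \<le> 17 / 100" using 4 False' \<open>\<not> odd n\<close> by (intro pot_large) auto
          moreover have "?A \<le> 1 / mu"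
          proof (cases "n = 4")
            case True
            then show ?thesis using False' pot3_edge[of "3 - 2 * e"] pot3_sym[of "2 * e"]
              by (auto simp: pot_simps)
          next
            case False
            then have "?A \<le> 17 / 100" using 4 False' \<open>\<not> odd n\<close> by (intro pot_large) (auto simp: of_nat_diff)
            then show ?thesis using mu_numeric by auto
          qed
          ultimately show ?thesis using mu_numeric by linarith
        qed
        moreover have "pot n e = 1 / 2" using 4 False alive assms by (auto simp: pot_def Let_def)
        ultimately show ?thesis using False by (simp add: rate_def)
      qed
    qed
  qed
qed

text \<open>
  The tent bends the chord away from a level in its lower half. Then only the steeper child can survive.
\<close>

lemma pot_drift_le:
  assumes "n \<ge> 1" "e \<le> real n / 2"
  shows "pot (n + 1) (2 * e) + pot (n - 1) (2 * e - real n - 1) \<le> rate n * pot n e"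
proof -
  consider "n = 1" | "n = 2" | "n = 3" | "n \<ge> 4" using assms by linarith
  then show ?thesis
  proof cases
    case 1
    then have "pot 0 (2 * e - 2) = 0" using assms pot1_eq_0[of "2 * \<bar>2 * e - 2\<bar>"] by (auto simp: pot_simps)
    then show ?thesis using 1 assms pot_split_le[of 1 e] pot_nonneg[of 0 "2 * e"]
      by (simp add: numeral_2_eq_2[symmetric])
  next
    case 2
    have "pot3 (2 * e) \<le> pot1 (2 * e) + pot3 (2 * e - 1)"
    proof -
      consider "2 * e < - 1 / 12" | "- 1 / 12 \<le> 2 * e" "2 * e \<le> 4 / 3" | "4 / 3 < 2 * e" by linarith
      then show ?thesis
      proof cases
        case 1
        then show ?thesis using pot3_eq_0[of "2 * e"] pot1_bounds(1)[of "2 * e"] pot3_nonneg[of "2 * e - 1"] by auto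
      next
        case 2
        then show ?thesis using pot3_le[of "2 * e"] pot1_ge[of "2 * e"] pot3_nonneg[of "2 * e - 1"] by auto
      next
        case 3
        then have "pot3 (2 * e - 1) = 1 / 2" using assms \<open>n = 2\<close> by (auto simp: pot3_def Let_def)
        then show ?thesis using pot3_le[of "2 * e"] pot1_bounds(1)[of "2 * e"] by auto
      qed
    qed
    moreover have "pot 1 (2 * e - 3) = 0" using assms 2 pot1_eq_0[of "2 * e - 3"] by (auto simp: pot_simps)
    ultimately show ?thesis using 2 assms by (simp add: pot_simps rate_def)
  next
    case 3
    have "pot 2 (2 * e - 4) = 0"
      using assms 3 pot1_eq_0[of "2 * (2 * e - 4)"] pot3_eq_0[of "2 * (2 * e - 4) - 1"] by (auto simp: pot_simps)
    moreover have "pot 4 (2 * e) \<le> mu * pot3 e"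
    proof -
      consider "e < - 1 / 12" | "- 1 / 12 \<le> e" "e < 0" | "0 \<le> e" "e \<le> 1 / 12" | "1 / 12 < e"
        by linarith
      then show ?thesis
      proof cases
        case 1
        then show ?thesis using pot_large(2)[of 4 "2 * e"] pot3_eq_0[of e] by auto
      next
        case 2
        then show ?thesis using pot_large(1)[of 4 "2 * e"] pot1_ge[of "4 * e"] pot3_neg[of e] mu_pos by auto
      next
        case 3
        then show ?thesis using pot_large(1)[of 4 "2 * e"] mu_pos by (auto simp: pot3_def)
      next
        case 4
        then have "pot3 e = 1 / 2" using assms \<open>n = 3\<close> by (auto simp: pot3_def Let_def)
        then have "mu * pot3 e = mu / 2" by simp
        then show ?thesis using pot_large(1)[of 4 "2 * e"] mu_bounds(1) by linarith
      qed
    qed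
    ultimately show ?thesis using 3 by (simp add: pot_simps rate_def)
  next
    case 4
    have A: "pot (n + 1) (2 * e) \<le> 1 / 2" using 4 by (intro pot_large) auto
    have B: "pot (n - 1) (2 * e - real n - 1) = 0"
      using 4 assms pot3_eq_0[of "2 * e - real n - 1"] pot_large(2)[of "n - 1" "2 * e - real n - 1"]
      by (cases "n = 4") (auto simp: pot_simps)
    show ?thesis
    proof (cases "e < - 1 / 12")
      case True
      then have "pot (n + 1) (2 * e) = 0" using 4 by (intro pot_large) auto
      then show ?thesis using B pot_nonneg[of n e] mu_pos by (simp add: rate_def)
    next
      case False
      then show ?thesis using 4 A B mu_numeric assms by (auto simp: rate_def pot_def[of n] Let_def)
    qed
  qed
qed

text \<open>
  A level in the upper half is brought to the lower half by exchanging the ends of the chord,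
  which also exchanges the two ways of bending.
\<close>

lemma pot_drift:
  assumes "n \<ge> 1"
  shows "pot (n + 1) (2 * e) + pot (n - 1) (2 * e - real n - 1) \<le> rate n * pot n e"
proof (cases "e \<le> real n / 2")
  case True
  then show ?thesis using pot_drift_le[OF assms] by blast
next
  case False
  have "pot (n + 1) (2 * e) = pot (n + 1) (2 * (real n - e) - real n + 1)"
    using pot_sym[of "n + 1" "2 * e"] by (simp add: algebra_simps)
  moreover have "pot (n - 1) (2 * e - real n - 1) = pot (n - 1) (2 * (real n - e))"
    using pot_sym[of "n - 1" "2 * (real n - e)"] assms by (simp add: of_nat_diff algebra_simps)
  ultimately show ?thesis
    using pot_split_le[OF assms, of "real n - e"] pot_sym[of n e] False by (simp add: algebra_simps)
qed

lemma pot_split: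
  assumes "n \<ge> 1"
  shows "pot (n - 1) (2 * e) + pot (n + 1) (2 * e - real n + 1) \<le> rate n * pot n e"
proof -
  have "pot (n + 1) (2 * (real n - e)) = pot (n + 1) (2 * e - real n + 1)"
    using pot_sym[of "n + 1" "2 * (real n - e)"] by (simp add: algebra_simps)
  moreover have "pot (n - 1) (2 * (real n - e) - real n - 1) = pot (n - 1) (2 * e)"
    using pot_sym[of "n - 1" "2 * e"] assms by (simp add: of_nat_diff algebra_simps)
  ultimately show ?thesis
    using pot_drift[OF assms, of "real n - e"] pot_sym[of n e] by (simp add: algebra_simps)
qed

lemma pot_flat: "2 * pot 1 (2 * e) \<le> pot 0 e" "2 * pot 1 (2 * e + 1) \<le> pot 0 e"
proof -
  have "pot1 (2 * e) \<le> pot1 (2 * \<bar>e\<bar>)" for e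
    using pot1_minus_le[of "- (2 * e)"] by (cases "0 \<le> e") auto
  from this[of e] this[of "- e"]
  show "2 * pot 1 (2 * e) \<le> pot 0 e" "2 * pot 1 (2 * e + 1) \<le> pot 0 e"
    using pot1_sym[of "2 * e + 1"] by (simp_all add: pot_simps)
qed

text \<open>
  A chord is now given by its signed slope \<open>s\<close> and its value \<open>c\<close> at the centre, measured from the
  level; the level then has height \<open>|s|/2 - c\<close> over the lower end.
\<close>

definition cell_pot :: "int \<Rightarrow> real \<Rightarrow> real" where
  "cell_pot s c = pot (nat \<bar>s\<bar>) (\<bar>of_int s\<bar> / 2 - c)"

lemma cell_pot_nonneg: "0 \<le> cell_pot s c"
  by (simp add: cell_pot_def pot_nonneg)

text \<open>
  Adding a tent of sign \<open>t\<close> raises the value at the centre by \<open>t/2\<close> before rescaling; the arguments on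
  the left are the slopes and centre values of the two halves, enlarged by the factor \<open>2\<close>. The three
  signs of \<open>s\<close> lead to the children of \<open>pot_flat\<close>, \<open>pot_split\<close> and \<open>pot_drift\<close>.
\<close>

lemma cell_pot_children:
  assumes "t = -1 \<or> t = 1"
  shows "cell_pot (s + t) (2 * c + (of_int t - of_int s) / 2) + cell_pot (s - t) (2 * c + (of_int t + of_int s) / 2)
    \<le> (if even s then 1 else mu) * cell_pot s c"
proof -
  define n where "n = nat \<bar>s\<bar>"
  define e where "e = \<bar>of_int s\<bar> / 2 - c"
  have rate: "(if even s then 1 else mu) = rate n"
    by (simp add: rate_def n_def even_nat_iff)
  have 2: "pot (n - 1) (2 * e) + pot (n + 1) (2 * e - real n + 1) \<le> rate n * pot n e"
    "pot (n + 1) (2 * e) + pot (n - 1) (2 * e - real n - 1) \<le> rate n * pot n e" if "n \<ge> 1"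
    using pot_split pot_drift that by blast+
  consider "s = 0" | "s > 0" | "s < 0" by linarith
  then show ?thesis
  proof cases
    case 1
    then show ?thesis using assms pot_flat[of e]
      by (auto simp: cell_pot_def e_def algebra_simps)
  next
    case s: 2
    then obtain k where k: "s = int (Suc k)" by (metis gr0_implies_Suc zero_less_imp_eq_int)
    then have n: "n = Suc k" and c: "c = (real k + 1) / 2 - e" by (auto simp: n_def e_def)
    have "cell_pot (s + 1) (2 * c + (1 - of_int s) / 2) = pot (n + 1) (2 * e)"
      "cell_pot (s - 1) (2 * c + (1 + of_int s) / 2) = pot (n - 1) (2 * e - real n - 1)"
      "cell_pot (s + - 1) (2 * c + (- 1 - of_int s) / 2) = pot (n - 1) (2 * e)"
      "cell_pot (s - - 1) (2 * c + (- 1 + of_int s) / 2) = pot (n + 1) (2 * e - real n + 1)"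
      unfolding cell_pot_def
      by (rule arg_cong2[where f = pot]; simp add: k n c nat_add_distrib field_simps)+
    then show ?thesis using assms 2 n unfolding rate by (auto simp: cell_pot_def n_def e_def)
  next
    case s: 3
    then obtain k where k: "s = - int (Suc k)" by (metis gr0_implies_Suc minus_equation_iff neg_0_less_iff_less zero_less_imp_eq_int)
    then have n: "n = Suc k" and c: "c = (real k + 1) / 2 - e" by (auto simp: n_def e_def)
    have "cell_pot (s + 1) (2 * c + (1 - of_int s) / 2) = pot (n - 1) (2 * e - real n - 1)"
      "cell_pot (s - 1) (2 * c + (1 + of_int s) / 2) = pot (n + 1) (2 * e)"
      "cell_pot (s + - 1) (2 * c + (- 1 - of_int s) / 2) = pot (n + 1) (2 * e - real n + 1)"
      "cell_pot (s - - 1) (2 * c + (- 1 + of_int s) / 2) = pot (n - 1) (2 * e)"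
      unfolding cell_pot_def
      by (rule arg_cong2[where f = pot]; simp add: k n c nat_add_distrib field_simps)+
    then show ?thesis using assms 2 n unfolding rate by (auto simp: cell_pot_def n_def e_def)
  qed
qed

text \<open>
  Up to slope \<open>3\<close> this is the largest vertical distance by which a tent series added to a chord of
  slope \<open>n\<close> can leave the range of the chord. For larger slopes it is only an upper bound for it.
\<close>

definition overshoot :: "nat \<Rightarrow> real" where
  "overshoot n = (2 / 3) / 2 ^ min n 3"

lemma overshoot_simps:
  "overshoot 0 = 2 / 3" "overshoot (Suc 0) = 1 / 3" "overshoot 2 = 1 / 6" "n \<ge> 3 \<Longrightarrow> overshoot n = 1 / 12"
  by (auto simp: overshoot_def min_def numeral_3_eq_3)

definition excess :: "int \<Rightarrow> real \<Rightarrow> real" where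
  "excess s c = \<bar>c\<bar> - \<bar>of_int s\<bar> / 2 - overshoot (nat \<bar>s\<bar>)"

lemma pot_ge:
  assumes "- overshoot n \<le> e" "e \<le> real n + overshoot n"
  shows "17 / 100 \<le> pot n e"
proof -
  consider "n = 0" | "n = 1" | "n = 2" | "n = 3" | "n \<ge> 4" by linarith
  then show ?thesis
  proof cases
    case 1
    then have "\<bar>e\<bar> \<le> 2 / 3" using assms by (auto simp: overshoot_simps)
    then have "623 / 1000 < pot1 (2 * \<bar>e\<bar>)" by (intro pot1_ge) auto
    then show ?thesis using 1 by (simp add: pot_simps)
  next
    case 2
    then show ?thesis using assms pot1_ge[of e] by (auto simp: pot_simps overshoot_simps)
  next
    case 3
    have *: "17 / 100 \<le> pot 2 d" if "- 1 / 6 \<le> d" "d \<le> 1" for d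
    proof (cases "2 * d \<le> 4 / 3")
      case True
      then show ?thesis using that pot1_ge[of "2 * d"] pot3_nonneg[of "2 * d - 1"] by (simp add: pot_simps)
    next
      case False
      then show ?thesis using that pot3_ge[of "2 * d - 1"] pot1_bounds(1)[of "2 * d"] by (simp add: pot_simps)
    qed
    show ?thesis using assms 3 *[of e] *[of "2 - e"] pot_sym[of 2 e]
      by (cases "e \<le> 1") (auto simp: overshoot_simps)
  next
    case 4
    then show ?thesis using assms pot3_ge[of e] by (auto simp: pot_simps overshoot_simps)
  next
    case 5
    then show ?thesis using assms pot_large(4)[of n e] by (auto simp: overshoot_simps)
  qed
qed

lemma cell_pot_ge: "excess s c \<le> 0 \<Longrightarrow> 17 / 100 \<le> cell_pot s c"
  unfolding cell_pot_def excess_def by (rule pot_ge) auto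

lemma overshoot_neighbour:
  assumes "n \<noteq> 0"
  shows "overshoot (n - 1) \<le> 2 * overshoot n" "overshoot (n + 1) \<le> 2 * overshoot n"
proof -
  have "n = 1 \<or> n = 2 \<or> n \<ge> 3" using assms by linarith
  then show "overshoot (n - 1) \<le> 2 * overshoot n" "overshoot (n + 1) \<le> 2 * overshoot n"
    by (auto simp: overshoot_def min_def eval_nat_numeral not_le le_Suc_eq)
qed

text \<open>
  A positive excess means that the level is too far away from the chord to be reached again. Doubling
  in every generation makes this visible: it contradicts any bound on the excess.
\<close>

lemma excess_child:
  assumes "t = -1 \<or> t = 1"
  shows "2 * excess s c \<le> excess (s + t) (2 * c + (of_int t - of_int s) / 2)"
    and "2 * excess s c \<le> excess (s - t) (2 * c + (of_int t + of_int s) / 2)"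
proof -
  have *: "2 * excess s c \<le> excess (s + u) (2 * c + w)"
    if u: "u = -1 \<or> u = 1" and w: "\<bar>w\<bar> = \<bar>of_int (s - u)\<bar> / 2" for u w
  proof (cases "s = 0")
    case True
    then show ?thesis using u w by (auto simp: excess_def overshoot_simps)
  next
    case False
    then have "\<bar>s + u\<bar> = \<bar>s\<bar> - 1 \<or> \<bar>s + u\<bar> = \<bar>s\<bar> + 1" using u by auto
    then have "nat \<bar>s + u\<bar> = nat \<bar>s\<bar> - 1 \<or> nat \<bar>s + u\<bar> = nat \<bar>s\<bar> + 1"
      by (auto simp: nat_diff_distrib nat_add_distrib)
    then have "overshoot (nat \<bar>s + u\<bar>) \<le> 2 * overshoot (nat \<bar>s\<bar>)"
      using overshoot_neighbour[of "nat \<bar>s\<bar>"] False by auto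
    moreover have "\<bar>of_int (s - u) :: real\<bar> + \<bar>of_int (s + u)\<bar> = 2 * \<bar>of_int s\<bar>"
    proof -
      have "\<bar>s - u\<bar> + \<bar>s + u\<bar> = 2 * \<bar>s\<bar>" using u False by auto
      then show ?thesis by (metis of_int_abs of_int_add of_int_mult of_int_numeral)
    qed
    moreover have "2 * \<bar>c\<bar> - \<bar>w\<bar> \<le> \<bar>2 * c + w\<bar>" by linarith
    ultimately show ?thesis using w unfolding excess_def right_diff_distrib by linarith
  qed
  show "2 * excess s c \<le> excess (s + t) (2 * c + (of_int t - of_int s) / 2)"
    using *[of t "(of_int t - of_int s) / 2"] assms by auto
  show "2 * excess s c \<le> excess (s - t) (2 * c + (of_int t + of_int s) / 2)"
    using *[of "- t" "(of_int t + of_int s) / 2"] assms by auto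
qed

section \<open>Hausdorff dimension through box counts and masses on dyadic intervals\<close>

lemma diam_powr_le:
  assumes "bounded U" "diameter U \<le> r" "0 < s"
  shows "diam_powr s U \<le> ennreal (r powr s)"
proof (cases "U = {}")
  case False
  have "diameter U powr s \<le> r powr s"
    using assms diameter_ge_0[OF assms(1)] by (intro powr_mono2) auto
  then show ?thesis using assms False by (simp add: diam_powr_def ennreal_leI)
qed (simp add: diam_powr_def)

text \<open>
  A finite cover is turned into a sequence by appending empty sets, which cost nothing.
\<close>

lemma hausdorff_premeasure_le_card:
  assumes "finite F" "A \<subseteq> \<Union>F" "\<And>U. U \<in> F \<Longrightarrow> bounded U \<and> diameter U \<le> r" "0 \<le> r" "r \<le> \<delta>" "0 < s"
  shows "hausdorff_premeasure \<delta> s A \<le> ennreal (card F * r powr s)"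
proof -
  obtain N g where g: "F = g ` {i::nat. i < N}" and N: "N = card F"
    using finite_imp_nat_seg_image_inj_on[OF assms(1)] by (metis card_Collect_less_nat card_image)
  define U where "U i = (if i < N then g i else {})" for i
  have U: "U i = {} \<or> U i \<in> F" for i
    using g by (auto simp: U_def)
  have "(\<Union>i. U i) = \<Union>F"
    using g by (auto simp: U_def)
  moreover have small: "bounded (U i) \<and> diameter (U i) \<le> r" for i
  proof (cases "U i = {}")
    case False
    then show ?thesis using U[of i] assms(3) by blast
  qed (simp add: assms(4) diameter_def)
  ultimately have "hausdorff_premeasure \<delta> s A \<le> (\<Sum>i. diam_powr s (U i))"
    using assms(2,5) unfolding hausdorff_premeasure_def by (intro INF_lower) (simp add: order_trans[of _ r])
  also have "\<dots> = (\<Sum>i<N. diam_powr s (U i))"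
    by (intro suminf_finite) (auto simp: U_def diam_powr_def)
  also have "\<dots> \<le> (\<Sum>i<N. ennreal (r powr s))"
    using small assms(6) by (intro sum_mono diam_powr_le) auto
  also have "\<dots> = ennreal (card F * r powr s)"
    by (simp add: N ennreal_mult' ennreal_of_nat_eq_real_of_nat)
  finally show ?thesis .
qed

lemma hausdorff_premeasure_mono:
  "A \<subseteq> B \<Longrightarrow> hausdorff_premeasure \<delta> s A \<le> hausdorff_premeasure \<delta> s B"
  unfolding hausdorff_premeasure_def by (intro INF_superset_mono order_refl) auto

text \<open>
  For \<open>t > s\<close> the covers cost \<open>K * r k powr (t - s)\<close>, which tends to \<open>0\<close>.
\<close>

lemma hausdorff_dim_le_box_count:
  assumes "r \<longlonglongrightarrow> 0" "\<And>k. 0 < r k" "0 \<le> s"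
    and cover: "\<And>k::nat. \<exists>F. finite F \<and> A \<subseteq> \<Union>F \<and> (\<forall>U\<in>F. bounded U \<and> diameter U \<le> r k) \<and>
        real (card F) \<le> K * r k powr (- s)"
  shows "hausdorff_dim A \<le> ereal s"
proof -
  have zero: "hausdorff_measure t A = 0" if "s < t" for t
  proof -
    have "hausdorff_premeasure \<delta> t A = 0" if "0 < \<delta>" for \<delta>
    proof -
      have "((\<lambda>k. K * r k powr (t - s)) \<longlongrightarrow> K * 0 powr (t - s)) sequentially"
        using assms(1,2) \<open>s < t\<close>
        by (intro tendsto_intros tendsto_powr2) (auto simp: less_imp_le)
      then have lim: "((\<lambda>k. ennreal (K * r k powr (t - s))) \<longlongrightarrow> 0) sequentially"
        using tendsto_ennrealI by fastforce
      have "eventually (\<lambda>k. hausdorff_premeasure \<delta> t A \<le> ennreal (K * r k powr (t - s))) sequentially"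
        using order_tendstoD(2)[OF assms(1) \<open>0 < \<delta>\<close>]
      proof eventually_elim
        case (elim k)
        obtain F where F: "finite F" "A \<subseteq> \<Union>F" "\<forall>U\<in>F. bounded U \<and> diameter U \<le> r k"
          "real (card F) \<le> K * r k powr (- s)"
          using cover by blast
        have "real (card F) * r k powr t \<le> K * r k powr (- s) * r k powr t"
          using F(4) by (intro mult_right_mono) auto
        also have "\<dots> = K * r k powr (t - s)"
          by (simp add: powr_add[symmetric])
        finally show ?case
          using hausdorff_premeasure_le_card[of F A "r k" \<delta> t] F elim assms(2,3) \<open>s < t\<close>
          by (meson ennreal_leI order_trans less_imp_le order_le_less_trans)
      qed
      then show ?thesis
        using tendsto_lowerbound[OF lim] by (simp add: eventually_mono)
    qed
    then show ?thesis by (simp add: hausdorff_measure_def)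
  qed
  show ?thesis
  proof (rule ereal_le_epsilon2)
    fix \<epsilon> :: real
    assume "0 < \<epsilon>"
    then have "hausdorff_dim A \<le> ereal (s + \<epsilon>)"
      using zero[of "s + \<epsilon>"] assms(3) unfolding hausdorff_dim_def by (intro INF_lower) auto
    then show "hausdorff_dim A \<le> ereal s + ereal \<epsilon>" by simp
  qed
qed

text \<open>
  The scale \<open>1\<close> is chosen because \<open>diameter U powr s\<close> does not increase with \<open>s\<close> for sets of diameter at most \<open>1\<close>.
  A lower bound for the premeasure at this single scale therefore suffices for the dimension.
\<close>

lemma hausdorff_measure_zero_mono:
  assumes "hausdorff_measure t A = 0" "0 \<le> t" "t \<le> s"
  shows "hausdorff_premeasure 1 s A = 0"
proof -
  have "hausdorff_premeasure 1 s A \<le> hausdorff_premeasure 1 t A"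
    unfolding hausdorff_premeasure_def
  proof (intro INF_superset_mono order_refl suminf_le summableI)
    fix U :: "nat \<Rightarrow> 'a set" and i
    assume "U \<in> {U. A \<subseteq> (\<Union>i. U i) \<and> (\<forall>i. bounded (U i) \<and> diameter (U i) \<le> 1)}"
    then have U: "bounded (U i)" "diameter (U i) \<le> 1" by auto
    then have "diameter (U i) powr s \<le> 1" "diameter (U i) powr s \<le> diameter (U i) powr t"
      using assms diameter_ge_0[OF U(1)] by (auto intro!: powr_le1 powr_mono')
    then show "diam_powr s (U i) \<le> diam_powr t (U i)"
      using assms by (auto simp: diam_powr_def ennreal_leI)
  qed
  also have "\<dots> = 0"
    using assms(1) SUP_upper[of 1 "{0<..}" "\<lambda>\<delta>. hausdorff_premeasure \<delta> t A"]
    by (simp add: hausdorff_measure_def)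
  finally show ?thesis by simp
qed

lemma hausdorff_dim_ge:
  assumes "hausdorff_premeasure 1 s A \<noteq> 0"
  shows "ereal s \<le> hausdorff_dim A"
  unfolding hausdorff_dim_def
proof (intro INF_greatest)
  fix t assume "t \<in> {t. 0 \<le> t \<and> hausdorff_measure t A = 0}"
  then show "ereal s \<le> ereal t"
    using hausdorff_measure_zero_mono[of t A s] assms by (cases "t \<le> s") auto
qed

text \<open>
  The cells are closed, so that they are compact and cover \<open>[0, 1]\<close> completely.
\<close>

definition dyadic_cell :: "nat \<Rightarrow> nat \<Rightarrow> real set" where
  "dyadic_cell n j = {real j / 2 ^ n .. (real j + 1) / 2 ^ n}"

lemma dyadic_cell_children:
  "dyadic_cell n j = dyadic_cell (Suc n) (2 * j) \<union> dyadic_cell (Suc n) (2 * j + 1)"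
proof -
  have "dyadic_cell (Suc n) (2 * j) = {real j / 2 ^ n .. (real j + 1 / 2) / 2 ^ n}"
    "dyadic_cell (Suc n) (2 * j + 1) = {(real j + 1 / 2) / 2 ^ n .. (real j + 1) / 2 ^ n}"
    by (auto simp: dyadic_cell_def field_simps)
  then show ?thesis
    using ivl_disj_un_two_touch(4)[of "real j / 2 ^ n" "(real j + 1 / 2) / 2 ^ n" "(real j + 1) / 2 ^ n"]
    by (simp add: dyadic_cell_def divide_right_mono)
qed

lemma sum_dyadic:
  fixes g :: "nat \<Rightarrow> 'a::comm_monoid_add"
  shows "(\<Sum>j<2 ^ Suc n. g j) = (\<Sum>j<2 ^ n. g (2 * j) + g (2 * j + 1))"
proof -
  have "(\<Sum>j<2 * N. g j) = (\<Sum>j<N. g (2 * j) + g (2 * j + 1))" for N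
    by (induction N) (simp_all add: add.assoc)
  then show ?thesis by simp
qed

text \<open>
  A finitely additive mass on the dyadic cells of \<open>[0, 1]\<close>. It replaces a measure: the mass distribution
  principle needs only the numbers that it assigns to cells.
\<close>

locale dyadic_mass =
  fixes m :: "nat \<Rightarrow> nat \<Rightarrow> real"
  assumes nonneg: "0 \<le> m n j"
    and additive: "m n j = m (Suc n) (2 * j) + m (Suc n) (2 * j + 1)"
begin

definition mass_meeting :: "nat \<Rightarrow> real set \<Rightarrow> real" where
  "mass_meeting n V = (\<Sum>j<2 ^ n. if dyadic_cell n j \<inter> V = {} then 0 else m n j)"

lemma mass_meeting_Suc: "mass_meeting (Suc n) V \<le> mass_meeting n V"
  unfolding mass_meeting_def sum_dyadic
proof (intro sum_mono)
  fix j
  show "(if dyadic_cell (Suc n) (2 * j) \<inter> V = {} then 0 else m (Suc n) (2 * j)) +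
        (if dyadic_cell (Suc n) (2 * j + 1) \<inter> V = {} then 0 else m (Suc n) (2 * j + 1))
     \<le> (if dyadic_cell n j \<inter> V = {} then 0 else m n j)"
    using dyadic_cell_children[of n j] additive[of n j] nonneg[of "Suc n" "2 * j"] nonneg[of "Suc n" "2 * j + 1"]
    by (auto split: if_splits)
qed

lemma mass_meeting_antimono: "n \<le> k \<Longrightarrow> mass_meeting k V \<le> mass_meeting n V"
  by (rule lift_Suc_antimono_le[of "\<lambda>k. mass_meeting k V"]) (rule mass_meeting_Suc)

lemma total: "(\<Sum>j<2 ^ n. m n j) = m 0 0"
proof (induction n)
  case (Suc n)
  then show ?case unfolding sum_dyadic by (simp only: additive[symmetric])
qed simp

text \<open>
  A ball of radius \<open>\<rho>\<close> meets at most four cells of a length between \<open>\<rho>\<close> and \<open>2\<rho>\<close>.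
\<close>

lemma mass_meeting_ball:
  assumes bound: "\<And>n j. m n j \<le> K * (1 / 2 ^ n) powr s" and "0 < s" "0 < \<rho>" "\<rho> \<le> 1"
  shows "\<exists>n. mass_meeting n (ball p \<rho>) \<le> 4 * K * 2 powr s * \<rho> powr s"
proof -
  have K: "0 \<le> K" using bound[of 0 0] nonneg[of 0 0] by simp
  obtain l :: nat where "(1 / 2) ^ l < \<rho>" using real_arch_pow_inv[of \<rho> "1/2"] assms by auto
  \<comment> \<open>The level \<open>n - 1\<close> is the last one at which cells are at least as long as the radius.\<close>
  define n where "n = (LEAST l. (1 / 2) ^ l < \<rho>)"
  have n: "(1 / 2) ^ n < \<rho>" unfolding n_def by (rule LeastI) fact
  then have "n \<noteq> 0" using assms by (intro notI) auto
  then have "\<rho> \<le> (1 / 2) ^ (n - 1)"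
    using not_less_Least[of "n - 1" "\<lambda>l. (1 / 2) ^ l < \<rho>"] by (simp add: n_def[symmetric] not_less)
  define k where "k = n - 1"
  have k: "\<rho> \<le> 1 / 2 ^ k" "1 / 2 ^ k < 2 * \<rho>"
    using \<open>\<rho> \<le> (1 / 2) ^ (n - 1)\<close> n \<open>n \<noteq> 0\<close>
    by (auto simp: k_def power_one_over power_eq_if[of _ n])
  let ?J = "{j. j < 2 ^ k \<and> dyadic_cell k j \<inter> ball p \<rho> \<noteq> {}}"
  have "?J \<subseteq> nat ` {\<lfloor>2 ^ k * p\<rfloor> - 2 .. \<lfloor>2 ^ k * p\<rfloor> + 1}"
  proof
    fix j assume "j \<in> ?J"
    then obtain x where x: "real j / 2 ^ k \<le> x" "x \<le> (real j + 1) / 2 ^ k" "\<bar>p - x\<bar> < \<rho>"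
      by (auto simp: dyadic_cell_def dist_real_def)
    then have "real j \<le> 2 ^ k * x" "2 ^ k * x \<le> real j + 1" by (auto simp: field_simps)
    moreover have "\<bar>2 ^ k * p - 2 ^ k * x\<bar> < 1"
    proof -
      have "\<bar>2 ^ k * p - 2 ^ k * x\<bar> = 2 ^ k * \<bar>p - x\<bar>"
        by (simp add: right_diff_distrib[symmetric] abs_mult)
      also have "\<dots> < 2 ^ k * \<rho>" using x by simp
      also have "\<dots> \<le> 1" using k by (simp add: field_simps)
      finally show ?thesis .
    qed
    ultimately have "\<lfloor>2 ^ k * p\<rfloor> - 2 \<le> int j" "int j \<le> \<lfloor>2 ^ k * p\<rfloor> + 1"
      by linarith+
    then show "j \<in> nat ` {\<lfloor>2 ^ k * p\<rfloor> - 2 .. \<lfloor>2 ^ k * p\<rfloor> + 1}"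
      by (intro image_eqI[of _ _ "int j"]) auto
  qed
  then have "card ?J \<le> card (nat ` {\<lfloor>2 ^ k * p\<rfloor> - 2 .. \<lfloor>2 ^ k * p\<rfloor> + 1})"
    by (intro card_mono) auto
  also have "\<dots> \<le> card {\<lfloor>2 ^ k * p\<rfloor> - 2 .. \<lfloor>2 ^ k * p\<rfloor> + 1}" by (rule card_image_le) simp
  finally have card: "card ?J \<le> 4" by simp
  have "mass_meeting k (ball p \<rho>) = (\<Sum>j\<in>?J. m k j)"
    unfolding mass_meeting_def by (intro sum.mono_neutral_cong_right) auto
  also have "\<dots> \<le> (\<Sum>j\<in>?J. K * (1 / 2 ^ k) powr s)" by (intro sum_mono bound)
  also have "\<dots> = card ?J * (K * (1 / 2 ^ k) powr s)" by simp
  also have "\<dots> \<le> 4 * (K * (1 / 2 ^ k) powr s)" using card K by (intro mult_right_mono) auto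
  also have "\<dots> \<le> 4 * (K * (2 * \<rho>) powr s)"
    using k assms K by (intro mult_left_mono powr_mono2) auto
  also have "\<dots> = 4 * K * 2 powr s * \<rho> powr s" using assms by (simp add: powr_mult)
  finally show ?thesis by blast
qed

definition support :: "real set" where
  "support = (\<Inter>n. \<Union>j\<in>{j. j < 2 ^ n \<and> 0 < m n j}. dyadic_cell n j)"

lemma positive_parent: "0 < m (Suc n) j \<Longrightarrow> 0 < m n (j div 2)"
proof -
  assume "0 < m (Suc n) j"
  moreover have "j = 2 * (j div 2) \<or> j = 2 * (j div 2) + 1" by presburger
  ultimately show "0 < m n (j div 2)"
    using additive[of n "j div 2"] nonneg[of "Suc n" "2 * (j div 2)"] nonneg[of "Suc n" "2 * (j div 2) + 1"]
    by (smt (verit, best))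
qed

lemma positive_descendant:
  assumes "j < 2 ^ n" "0 < m n j"
  shows "\<exists>i<2 ^ (n + k). dyadic_cell (n + k) i \<subseteq> dyadic_cell n j \<and> 0 < m (n + k) i"
proof (induction k)
  case 0
  then show ?case using assms by auto
next
  case (Suc k)
  then obtain i where i: "i < 2 ^ (n + k)" "dyadic_cell (n + k) i \<subseteq> dyadic_cell n j" "0 < m (n + k) i" by blast
  have "0 < m (Suc (n + k)) (2 * i) \<or> 0 < m (Suc (n + k)) (2 * i + 1)"
    using additive[of "n + k" i] i(3) by linarith
  moreover have "2 * i < 2 ^ Suc (n + k)" "2 * i + 1 < 2 ^ Suc (n + k)" using i(1) by auto
  moreover have "dyadic_cell (Suc (n + k)) (2 * i) \<subseteq> dyadic_cell n j"
    "dyadic_cell (Suc (n + k)) (2 * i + 1) \<subseteq> dyadic_cell n j"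
    using i(2) unfolding dyadic_cell_children[of "n + k" i] by blast+
  ultimately show ?case unfolding add_Suc_right by blast
qed

text \<open>
  A cell of positive mass has descendants of positive mass on every level, and the corresponding
  compact sets are nested.
\<close>

lemma support_meets:
  assumes "j < 2 ^ n" "0 < m n j"
  shows "dyadic_cell n j \<inter> support \<noteq> {}"
proof -
  define L where "L n = (\<Union>j\<in>{j. j < 2 ^ n \<and> 0 < m n j}. dyadic_cell n j)" for n
  have L_Suc: "L (Suc n) \<subseteq> L n" for n
  proof
    fix x assume "x \<in> L (Suc n)"
    then obtain i where i: "i < 2 ^ Suc n" "0 < m (Suc n) i" "x \<in> dyadic_cell (Suc n) i" by (auto simp: L_def)
    have "i = 2 * (i div 2) \<or> i = 2 * (i div 2) + 1" by presburger
    then have "x \<in> dyadic_cell n (i div 2)"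
      using i(3) unfolding dyadic_cell_children[of n "i div 2"] by (metis UnCI)
    moreover have "i div 2 < 2 ^ n" using i(1) by (simp add: less_mult_imp_div_less mult.commute)
    ultimately show "x \<in> L n" using positive_parent[OF i(2)] by (auto simp: L_def)
  qed
  have L_anti: "L k \<subseteq> L i" if "i \<le> k" for i k
    using lift_Suc_antimono_le[of L] L_Suc that by blast
  have "compact (L k)" for k
    unfolding L_def by (intro compact_UN) (auto simp: dyadic_cell_def)
  then have "compact (dyadic_cell n j \<inter> L (n + k))" for k
    by (intro compact_Int) (simp add: dyadic_cell_def)
  moreover have "dyadic_cell n j \<inter> L (n + k) \<noteq> {}" for k
  proof -
    obtain i where i: "i < 2 ^ (n + k)" "dyadic_cell (n + k) i \<subseteq> dyadic_cell n j" "0 < m (n + k) i"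
      using positive_descendant[OF assms] by blast
    have "real i / 2 ^ (n + k) \<in> dyadic_cell (n + k) i" by (simp add: dyadic_cell_def divide_right_mono)
    then show ?thesis using i by (auto simp: L_def)
  qed
  moreover have "dyadic_cell n j \<inter> L (n + b) \<subseteq> dyadic_cell n j \<inter> L (n + a)" if "a \<le> b" for a b
    using L_anti[of "n + a" "n + b"] that by auto
  ultimately have "\<Inter> (range (\<lambda>k. dyadic_cell n j \<inter> L (n + k))) \<noteq> {}"
    by (rule compact_nest)
  then obtain x where x: "\<And>k. x \<in> dyadic_cell n j \<and> x \<in> L (n + k)" by blast
  have "x \<in> L k" for k using x[of k] L_anti[of k "n + k"] by auto
  then show ?thesis using x by (auto simp: support_def L_def)
qed

lemma compact_support: "compact support"
proof -
  have "closed support"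
    unfolding support_def by (intro closed_INT ballI closed_UN) (auto simp: dyadic_cell_def)
  moreover have "support \<subseteq> (\<Union>j\<in>{j. j < 2 ^ 0 \<and> 0 < m 0 j}. dyadic_cell 0 j)"
    unfolding support_def by (rule INT_lower) simp
  moreover have "compact (\<Union>j\<in>{j. j < 2 ^ 0 \<and> 0 < m 0 j}. dyadic_cell 0 j)"
    by (intro compact_UN) (auto simp: dyadic_cell_def)
  ultimately show ?thesis by (metis closed_Int_compact inf.absorb1)
qed

text \<open>
  If the premeasure vanished, there would be a cover of small cost. Enlarging its members to balls whose
  \<open>s\<close>-th powers of radii exceed the cost by \<open>\<epsilon> / 2^(i+1)\<close> makes compactness applicable, and on a level that is
  fine enough for the finitely many remaining balls, the cells meeting them carry the whole mass. By
  \<open>mass_meeting_ball\<close> this mass is bounded by a multiple of the cost.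
\<close>

theorem mass_distribution:
  assumes E: "compact E" and pos: "0 < m 0 0"
    and meets: "\<And>n j. j < 2 ^ n \<Longrightarrow> 0 < m n j \<Longrightarrow> dyadic_cell n j \<inter> E \<noteq> {}"
    and bound: "\<And>n j. m n j \<le> K * (1 / 2 ^ n) powr s" and s: "0 < s"
  shows "hausdorff_premeasure 1 s E \<noteq> 0"
proof
  assume zero: "hausdorff_premeasure 1 s E = 0"
  have K: "0 < K" using bound[of 0 0] pos by simp
  define C where "C = 4 * K * 2 powr s"
  have C: "0 < C" "m 0 0 \<le> C"
  proof -
    have "K * 1 \<le> K * (4 * 2 powr s)" using K s ge_one_powr_ge_zero[of 2 s] by (intro mult_left_mono) auto
    then have "K \<le> C" by (simp add: C_def)
    then show "m 0 0 \<le> C" "0 < C" using bound[of 0 0] K by auto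
  qed
  define \<epsilon> where "\<epsilon> = m 0 0 / (4 * C)"
  have \<epsilon>: "0 < \<epsilon>" using C pos by (simp add: \<epsilon>_def)
  have "hausdorff_premeasure 1 s E < ennreal \<epsilon>" using zero \<epsilon> by simp
  then obtain U where U: "E \<subseteq> (\<Union>i. U i)" "\<And>i. bounded (U i)" "\<And>i. diameter (U i) \<le> 1"
    "(\<Sum>i. diam_powr s (U i)) < ennreal \<epsilon>"
    unfolding hausdorff_premeasure_def INF_less_iff by auto
  define d where "d i = (if U i = {} then 0 else diameter (U i) powr s)" for i
  have d: "diam_powr s (U i) = ennreal (d i)" for i using s by (simp add: d_def diam_powr_def)
  have d0: "0 \<le> d i" for i by (simp add: d_def)
  have sum_d: "sum d I < \<epsilon>" if "finite I" for I
  proof -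
    have "ennreal (sum d I) = (\<Sum>i\<in>I. diam_powr s (U i))" using d d0 by (simp add: sum_ennreal)
    also have "\<dots> \<le> (\<Sum>i. diam_powr s (U i))" using that by (intro sum_le_suminf) auto
    also have "\<dots> < ennreal \<epsilon>" by (rule U)
    finally show ?thesis using \<epsilon> by (simp add: ennreal_less_iff d0 sum_nonneg)
  qed
  define \<rho> where "\<rho> i = (d i + \<epsilon> * (1 / 2) ^ Suc i) powr (1 / s)" for i
  have arg: "0 < d i + \<epsilon> * (1 / 2) ^ Suc i" for i using d0[of i] \<epsilon> by (simp add: add_nonneg_pos)
  have \<rho>: "0 < \<rho> i" "\<rho> i powr s = d i + \<epsilon> * (1 / 2) ^ Suc i" for i
    using arg[of i] s by (auto simp: \<rho>_def powr_powr)
  have \<rho>_gt: "diameter (U i) < \<rho> i" if "U i \<noteq> {}" for i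
  proof (rule ccontr)
    assume "\<not> ?thesis"
    then have "\<rho> i powr s \<le> diameter (U i) powr s" using \<rho>[of i] s by (intro powr_mono2) auto
    moreover have "0 < \<epsilon> * (1 / 2) ^ Suc i" using \<epsilon> by (intro mult_pos_pos zero_less_power) auto
    ultimately show False using \<rho>(2)[of i] that unfolding d_def by auto
  qed
  define V where "V i = (if U i = {} then {} else ball (SOME p. p \<in> U i) (\<rho> i))" for i
  have UV: "U i \<subseteq> V i" for i
  proof
    fix x assume x: "x \<in> U i"
    then have p: "(SOME p. p \<in> U i) \<in> U i" by (rule someI)
    have "dist (SOME p. p \<in> U i) x \<le> diameter (U i)" using diameter_bounded_bound[OF U(2) p x] .
    moreover have ne: "U i \<noteq> {}" using x by blast
    ultimately show "x \<in> V i" using \<rho>_gt[OF ne] by (simp add: V_def)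
  qed
  have V_open: "open (V i)" for i by (simp add: V_def)
  have "(\<Union>i. U i) \<subseteq> (\<Union>i. V i)" by (intro UN_mono UV order_refl)
  with U(1) have "E \<subseteq> (\<Union>i. V i)" by (rule order_trans)
  then obtain I where "I \<subseteq> UNIV" and I: "finite I" "E \<subseteq> (\<Union>i\<in>I. V i)"
    by (rule compactE_image[OF E V_open])
  have "\<exists>n. mass_meeting n (V i) \<le> C * \<rho> i powr s" for i
  proof (cases "U i = {}")
    case True
    then show ?thesis using C by (simp add: V_def mass_meeting_def)
  next
    case False
    show ?thesis
    proof (cases "\<rho> i \<le> 1")
      case True
      then show ?thesis using mass_meeting_ball[OF bound s \<rho>(1) True] False by (simp add: V_def C_def)
    next
      case False
      have "mass_meeting 0 (V i) \<le> m 0 0"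
        unfolding total[of 0, symmetric] mass_meeting_def by (intro sum_mono) (auto simp: nonneg)
      also have "\<dots> \<le> C * 1" using C by simp
      also have "\<dots> \<le> C * \<rho> i powr s" using C False s by (intro mult_left_mono ge_one_powr_ge_zero) auto
      finally show ?thesis by blast
    qed
  qed
  then obtain lev where lev: "\<And>i. mass_meeting (lev i) (V i) \<le> C * \<rho> i powr s" by metis
  define n where "n = Max (insert 0 (lev ` I))"
  have mass_meeting: "mass_meeting n (V i) \<le> C * \<rho> i powr s" if "i \<in> I" for i
    using mass_meeting_antimono[of "lev i" n "V i"] lev[of i] I(1) that by (auto simp: n_def intro: order_trans)
  have "m 0 0 = (\<Sum>j<2 ^ n. m n j)" by (simp add: total)
  also have "\<dots> \<le> (\<Sum>j<2 ^ n. \<Sum>i\<in>I. if dyadic_cell n j \<inter> V i = {} then 0 else m n j)"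
  proof (intro sum_mono)
    fix j assume j: "j \<in> {..<(2::nat) ^ n}"
    show "m n j \<le> (\<Sum>i\<in>I. if dyadic_cell n j \<inter> V i = {} then 0 else m n j)"
    proof (cases "m n j = 0")
      case False
      then have "dyadic_cell n j \<inter> E \<noteq> {}" using meets[of j n] nonneg[of n j] j by auto
      then obtain i where "i \<in> I" "dyadic_cell n j \<inter> V i \<noteq> {}" using I(2) by blast
      then show ?thesis
        using member_le_sum[of i I "\<lambda>i. if dyadic_cell n j \<inter> V i = {} then 0 else m n j"] I(1) nonneg[of n j]
        by auto
    qed (simp add: sum_nonneg)
  qed
  also have "\<dots> = (\<Sum>i\<in>I. mass_meeting n (V i))" unfolding mass_meeting_def by (rule sum.swap)
  also have "\<dots> \<le> (\<Sum>i\<in>I. C * \<rho> i powr s)" using mass_meeting by (intro sum_mono)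
  also have "\<dots> = C * (sum d I + \<epsilon> * (\<Sum>i\<in>I. (1 / 2) ^ Suc i))"
    by (simp add: \<rho>(2) sum_distrib_left sum.distrib distrib_left)
  also have "\<dots> \<le> C * (\<epsilon> + \<epsilon> * 1)"
  proof (intro mult_left_mono add_mono)
    have "(\<Sum>i\<in>I. (1 / 2 :: real) ^ Suc i) \<le> (\<Sum>i. (1 / 2) ^ Suc i)"
      using I(1) by (intro sum_le_suminf) (auto simp: power_half_series sums_summable[OF power_half_series])
    then show "(\<Sum>i\<in>I. (1 / 2 :: real) ^ Suc i) \<le> 1" using sums_unique[OF power_half_series] by simp
  qed (use sum_d[OF I(1)] C \<epsilon> in auto)
  also have "\<dots> < m 0 0" using C pos by (simp add: \<epsilon>_def)
  finally show False by simp
qed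

end

section \<open>Chords of a tent series and the upper bound\<close>

lemma phi_on_unit:
  assumes "0 \<le> t" "t \<le> 1"
  shows "phi (real j + t) = min t (1 - t)"
  unfolding phi_def
proof (rule antisym)
  have "infdist (real j + t) \<int> \<le> dist (real j + t) (real j)"
    "infdist (real j + t) \<int> \<le> dist (real j + t) (real (j + 1))"
    by (rule infdist_le; simp)+
  then show "infdist (real j + t) \<int> \<le> min t (1 - t)"
    using assms by (auto simp: dist_real_def)
  have "min t (1 - t) \<le> dist (real j + t) z" if z: "z \<in> \<int>" for z
  proof -
    obtain i where i: "z = of_int i" using z by (auto elim: Ints_cases)
    have "i \<le> int j \<or> int j + 1 \<le> i" by linarith
    then have "z \<le> real j \<or> real j + 1 \<le> z" unfolding i by linarith
    then show ?thesis using assms by (auto simp: dist_real_def)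
  qed
  then show "min t (1 - t) \<le> infdist (real j + t) \<int>"
    using Ints_0 by (auto simp: infdist_def intro!: cINF_greatest)
qed

lemma phi_bounds: "0 \<le> phi x" "phi x \<le> 1 / 2"
proof -
  show "0 \<le> phi x" by (simp add: phi_def infdist_nonneg)
  have "phi x \<le> dist x (of_int (round x))"
    unfolding phi_def by (rule infdist_le) simp
  also have "\<dots> \<le> 1 / 2"
    using of_int_round_abs_le[of x] by (simp add: dist_real_def abs_minus_commute)
  finally show "phi x \<le> 1 / 2" .
qed

text \<open>
  Slope and centre value of the chord over the cell \<open>j\<close> of generation \<open>n\<close>, for \<open>2^n (f_n - y)\<close> rescaled to cell
  length \<open>1\<close>. The sign \<open>\<tau>\<close> of the next tent may depend on the chord itself, which allows signs to be chosen
  in response to the position of the level. The recursion makes no reference to \<open>j < 2^n\<close>, and the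
  relations between a cell and its children hold for every \<open>j\<close>.
\<close>

primrec chord :: "(nat \<Rightarrow> nat \<Rightarrow> int \<times> real \<Rightarrow> int) \<Rightarrow> real \<Rightarrow> nat \<Rightarrow> nat \<Rightarrow> int \<times> real" where
  "chord \<tau> y 0 j = (0, - y)"
| "chord \<tau> y (Suc n) j = (let p = chord \<tau> y n (j div 2); s = fst p; c = snd p; t = \<tau> n (j div 2) p in
     if even j then (s + t, 2 * c + (of_int t - of_int s) / 2)
     else (s - t, 2 * c + (of_int t + of_int s) / 2))"

locale tent_series =
  fixes \<tau> :: "nat \<Rightarrow> nat \<Rightarrow> int \<times> real \<Rightarrow> int" and y :: real
    and \<omega> :: "nat \<Rightarrow> real \<Rightarrow> real" and f :: "real \<Rightarrow> real"
  assumes sign: "\<tau> n j p = -1 \<or> \<tau> n j p = 1"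
    and \<omega>_sign: "x \<in> {0..1} \<Longrightarrow> \<omega> n x \<in> {-1, 1}"
    and \<omega>_cell: "j < 2 ^ n \<Longrightarrow> x \<in> {real j / 2 ^ n ..< (real j + 1) / 2 ^ n} \<Longrightarrow>
      \<omega> n x = of_int (\<tau> n j (chord \<tau> y n j))"
    and series: "x \<in> {0..1} \<Longrightarrow> (\<lambda>n. \<omega> n x / 2 ^ n * phi (2 ^ n * x)) sums f x"
begin

definition slope :: "nat \<Rightarrow> nat \<Rightarrow> int" where
  "slope n j = fst (chord \<tau> y n j)"

definition centre :: "nat \<Rightarrow> nat \<Rightarrow> real" where
  "centre n j = snd (chord \<tau> y n j)"

definition bend :: "nat \<Rightarrow> nat \<Rightarrow> int" where
  "bend n j = \<tau> n j (chord \<tau> y n j)"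

definition weight :: "nat \<Rightarrow> nat \<Rightarrow> real" where
  "weight n j = cell_pot (slope n j) (centre n j)"

lemma bend_sign: "bend n j = -1 \<or> bend n j = 1"
  using sign by (simp add: bend_def)

lemma root: "slope 0 j = 0" "centre 0 j = - y"
  by (simp_all add: slope_def centre_def)

lemma left:
  "slope (Suc n) (2 * j) = slope n j + bend n j"
  "centre (Suc n) (2 * j) = 2 * centre n j + (of_int (bend n j) - of_int (slope n j)) / 2"
  by (simp_all add: slope_def centre_def bend_def Let_def)

lemma right:
  "slope (Suc n) (2 * j + 1) = slope n j - bend n j"
  "centre (Suc n) (2 * j + 1) = 2 * centre n j + (of_int (bend n j) + of_int (slope n j)) / 2"
  by (simp_all add: slope_def centre_def bend_def Let_def)

lemma even_slope: "even (slope n j) \<longleftrightarrow> even n"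
proof (induction n arbitrary: j)
  case (Suc n)
  have "slope (Suc n) j = slope n (j div 2) + bend n (j div 2) \<or> slope (Suc n) j = slope n (j div 2) - bend n (j div 2)"
    by (simp add: slope_def bend_def Let_def)
  then show ?case using Suc[of "j div 2"] bend_sign[of n "j div 2"] by auto
qed (simp add: root)

lemma weight_nonneg: "0 \<le> weight n j"
  by (simp add: weight_def cell_pot_nonneg)

lemma weight_children: "weight (Suc n) (2 * j) + weight (Suc n) (2 * j + 1) \<le> (if even n then 1 else mu) * weight n j"
  unfolding weight_def left right even_slope[symmetric, of n j] by (rule cell_pot_children[OF bend_sign])

lemma total_weight: "(\<Sum>j<2 ^ n. weight n j) \<le> mu ^ (n div 2) * weight 0 0"
proof (induction n)
  case (Suc n)
  have "(\<Sum>j<2 ^ Suc n. weight (Suc n) j) \<le> (\<Sum>j<2 ^ n. (if even n then 1 else mu) * weight n j)"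
    unfolding sum_dyadic by (intro sum_mono weight_children)
  also have "\<dots> = (if even n then 1 else mu) * (\<Sum>j<2 ^ n. weight n j)" by (simp add: sum_distrib_left)
  also have "\<dots> \<le> (if even n then 1 else mu) * (mu ^ (n div 2) * weight 0 0)"
    using mu_pos by (intro mult_left_mono Suc) auto
  also have "\<dots> = mu ^ (Suc n div 2) * weight 0 0" by simp
  finally show ?case .
qed simp

definition partial :: "nat \<Rightarrow> real \<Rightarrow> real" where
  "partial n x = (\<Sum>i<n. \<omega> i x / 2 ^ i * phi (2 ^ i * x))"

text \<open>
  The formula also holds at the right end of a cell, where the sign belongs to the next cell: the term
  added there vanishes, because \<open>2^n x\<close> is an integer.
\<close>

lemma partial_on_cell:
  assumes "j < 2 ^ n" "x \<in> dyadic_cell n j"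
  shows "2 ^ n * (partial n x - y) = centre n j + of_int (slope n j) * (2 ^ n * x - real j - 1 / 2)"
  using assms
proof (induction n arbitrary: j)
  case 0
  then show ?case by (simp add: partial_def root)
next
  case (Suc n)
  define p where "p = j div 2"
  have p: "p < 2 ^ n" using Suc.prems(1) by (simp add: p_def less_mult_imp_div_less mult.commute)
  have j: "j = 2 * p \<or> j = 2 * p + 1" unfolding p_def by presburger
  have x: "x \<in> dyadic_cell n p" using Suc.prems(2) j unfolding dyadic_cell_children[of n p] by blast
  define t where "t = 2 ^ n * x - real p"
  have t: "0 \<le> t" "t \<le> 1" "2 ^ n * x = real p + t"
    using x by (auto simp: t_def dyadic_cell_def field_simps)
  have phi: "phi (2 ^ n * x) = min t (1 - t)"
    unfolding t(3) by (rule phi_on_unit) fact+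
  have "\<omega> n x * min t (1 - t) = of_int (bend n p) * min t (1 - t)"
  proof (cases "t < 1")
    case True
    then have "x \<in> {real p / 2 ^ n ..< (real p + 1) / 2 ^ n}"
      using t by (auto simp: field_simps)
    then show ?thesis using \<omega>_cell[OF p] by (simp add: bend_def)
  next
    case False
    then show ?thesis using t by simp
  qed
  then have "partial (Suc n) x = partial n x + of_int (bend n p) * min t (1 - t) / 2 ^ n"
    by (simp add: partial_def phi)
  then have "2 ^ Suc n * (partial (Suc n) x - y) = 2 * (2 ^ n * (partial n x - y)) + 2 * (of_int (bend n p) * min t (1 - t))"
    by (simp add: field_simps)
  also have "2 ^ n * (partial n x - y) = centre n p + of_int (slope n p) * (t - 1 / 2)"
    using Suc.IH[OF p x] by (simp add: t_def)
  finally have eq: "2 ^ Suc n * (partial (Suc n) x - y) =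
      2 * (centre n p + of_int (slope n p) * (t - 1 / 2)) + 2 * (of_int (bend n p) * min t (1 - t))" .
  from j show ?case
  proof
    assume j: "j = 2 * p"
    then have "min t (1 - t) = t" "2 ^ Suc n * x - real j = 2 * t"
      using Suc.prems(2) t by (auto simp: dyadic_cell_def field_simps)
    then show ?thesis unfolding eq unfolding j left by (simp add: field_simps)
  next
    assume j: "j = 2 * p + 1"
    then have "min t (1 - t) = 1 - t" "2 ^ Suc n * x - real j = 2 * t - 1"
      using Suc.prems(2) t by (auto simp: dyadic_cell_def field_simps)
    then show ?thesis unfolding eq unfolding j right by (simp add: field_simps)
  qed
qed

lemma tail_bound:
  assumes x: "x \<in> {0..1}"
  shows "\<bar>2 ^ n * (f x - partial n x)\<bar> \<le> 1"
proof -
  define a where "a i = \<omega> i x / 2 ^ i * phi (2 ^ i * x)" for i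
  have tail: "(\<lambda>i. a (i + n)) sums (f x - partial n x)"
    using sums_split_initial_segment[OF series[OF x], of n] by (simp add: a_def partial_def)
  have geo: "(\<lambda>i. (1 / 2) ^ n * (1 / 2 :: real) ^ Suc i) sums ((1 / 2) ^ n * 1)"
    by (rule sums_mult[OF power_half_series])
  have bound: "\<bar>a (i + n)\<bar> \<le> (1 / 2) ^ n * (1 / 2) ^ Suc i" for i
  proof -
    have "\<bar>\<omega> (i + n) x\<bar> = 1" using \<omega>_sign[OF x, of "i + n"] by auto
    then have "\<bar>a (i + n)\<bar> = phi (2 ^ (i + n) * x) / 2 ^ (i + n)"
      using phi_bounds(1)[of "2 ^ (i + n) * x"] by (simp add: a_def abs_mult)
    also have "\<dots> \<le> (1 / 2) / 2 ^ (i + n)" by (intro divide_right_mono phi_bounds) simp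
    finally show ?thesis by (simp add: power_add power_one_over field_simps)
  qed
  have "- (f x - partial n x) \<le> (1 / 2) ^ n * 1" "f x - partial n x \<le> (1 / 2) ^ n * 1"
    using sums_le[OF abs_le_D2[OF bound] sums_minus[OF tail] geo] sums_le[OF abs_le_D1[OF bound] tail geo]
    by blast+
  then have "\<bar>f x - partial n x\<bar> \<le> 1 / 2 ^ n" by (simp add: power_one_over)
  then show ?thesis by (simp add: abs_mult pos_le_divide_eq mult.commute)
qed

lemma dyadic_cell_unit: "j < 2 ^ n \<Longrightarrow> dyadic_cell n j \<subseteq> {0..1}"
proof
  fix x assume j: "j < 2 ^ n" and x: "x \<in> dyadic_cell n j"
  from j have "real j + 1 \<le> 2 ^ n"
    by (metis Suc_leI add.commute of_nat_Suc of_nat_le_iff of_nat_numeral of_nat_power)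
  then have "0 \<le> real j / 2 ^ n" "(real j + 1) / 2 ^ n \<le> 1" by simp_all
  then show "x \<in> {0..1}" using x unfolding dyadic_cell_def atLeastAtMost_iff by linarith
qed

lemma excess_le_1:
  assumes "j < 2 ^ n" "x \<in> dyadic_cell n j" "f x = y"
  shows "excess (slope n j) (centre n j) \<le> 1"
proof -
  define u where "u = 2 ^ n * x - real j - 1 / 2"
  have u: "\<bar>u\<bar> \<le> 1 / 2" using assms(2) by (auto simp: u_def dyadic_cell_def field_simps abs_le_iff)
  have "\<bar>centre n j + of_int (slope n j) * u\<bar> \<le> 1"
    using partial_on_cell[OF assms(1,2)] tail_bound[of x n] dyadic_cell_unit[OF assms(1)] assms(2,3)
    by (auto simp: u_def abs_minus_commute right_diff_distrib)
  moreover have "\<bar>of_int (slope n j) * u\<bar> \<le> \<bar>of_int (slope n j)\<bar> * (1 / 2)"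
    unfolding abs_mult by (intro mult_left_mono u) simp
  moreover have "0 \<le> overshoot (nat \<bar>slope n j\<bar>)" by (simp add: overshoot_def)
  ultimately show ?thesis by (simp add: excess_def)
qed

lemma descendant_excess:
  assumes "j < 2 ^ n" "x \<in> dyadic_cell n j"
  shows "\<exists>i<2 ^ (n + k). x \<in> dyadic_cell (n + k) i \<and>
    2 ^ k * excess (slope n j) (centre n j) \<le> excess (slope (n + k) i) (centre (n + k) i)"
proof (induction k)
  case 0
  then show ?case using assms by auto
next
  case (Suc k)
  then obtain i where i: "i < 2 ^ (n + k)" "x \<in> dyadic_cell (n + k) i"
    "2 ^ k * excess (slope n j) (centre n j) \<le> excess (slope (n + k) i) (centre (n + k) i)" by blast
  have "2 * excess (slope (n + k) i) (centre (n + k) i) \<le> excess (slope (Suc (n + k)) (2 * i)) (centre (Suc (n + k)) (2 * i))"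
    "2 * excess (slope (n + k) i) (centre (n + k) i) \<le> excess (slope (Suc (n + k)) (2 * i + 1)) (centre (Suc (n + k)) (2 * i + 1))"
    unfolding left right by (rule excess_child[OF bend_sign])+
  then have "2 ^ Suc k * excess (slope n j) (centre n j) \<le> excess (slope (Suc (n + k)) (2 * i)) (centre (Suc (n + k)) (2 * i))"
    "2 ^ Suc k * excess (slope n j) (centre n j) \<le> excess (slope (Suc (n + k)) (2 * i + 1)) (centre (Suc (n + k)) (2 * i + 1))"
    using i(3) by simp_all
  moreover have "x \<in> dyadic_cell (Suc (n + k)) (2 * i) \<or> x \<in> dyadic_cell (Suc (n + k)) (2 * i + 1)"
    using i(2) unfolding dyadic_cell_children[of "n + k" i] by blast
  moreover have "2 * i < 2 ^ Suc (n + k)" "2 * i + 1 < 2 ^ Suc (n + k)" using i(1) by auto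
  ultimately show ?case unfolding add_Suc_right by blast
qed

text \<open>
  The excess of a cell that contains a point of the level set is at most \<open>1\<close>. A positive excess would grow
  beyond this bound in the descendants that contain the same point.
\<close>

lemma weight_ge:
  assumes "j < 2 ^ n" "x \<in> dyadic_cell n j" "f x = y"
  shows "17 / 100 \<le> weight n j"
proof -
  have "excess (slope n j) (centre n j) \<le> 0"
  proof (rule ccontr)
    assume "\<not> ?thesis"
    then have pos: "0 < excess (slope n j) (centre n j)" by simp
    obtain k where "1 / excess (slope n j) (centre n j) < 2 ^ k"
      using real_arch_pow[of 2] by auto
    then have "1 < 2 ^ k * excess (slope n j) (centre n j)" using pos by (simp add: field_simps)
    moreover obtain i where "i < 2 ^ (n + k)" "x \<in> dyadic_cell (n + k) i"
      "2 ^ k * excess (slope n j) (centre n j) \<le> excess (slope (n + k) i) (centre (n + k) i)"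
      using descendant_excess[OF assms(1,2)] by blast
    ultimately show False using excess_le_1[of i "n + k" x] assms(3) by simp
  qed
  then show ?thesis unfolding weight_def by (rule cell_pot_ge)
qed

lemma dim_level_set_le: "hausdorff_dim (level_set f y) \<le> ereal d_v_star"
proof (rule hausdorff_dim_le_box_count[where r = "\<lambda>k. 1 / 2 ^ (2 * k)" and K = "weight 0 0 / (17 / 100)"])
  have "(\<lambda>k. (1 / 4 :: real) ^ k) \<longlonglongrightarrow> 0" by (rule LIMSEQ_power_zero) simp
  then show "(\<lambda>k. 1 / 2 ^ (2 * k) :: real) \<longlonglongrightarrow> 0" by (simp add: power_mult power_one_over)
  show "0 \<le> d_v_star" using d_v_star_pos by simp
  fix k :: nat
  define n where "n = 2 * k"
  define J where "J = {j. j < 2 ^ n \<and> dyadic_cell n j \<inter> level_set f y \<noteq> {}}"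
  have J: "finite J" "J \<subseteq> {..<2 ^ n}" by (auto simp: J_def)
  have "real (card J) * (17 / 100) = (\<Sum>j\<in>J. 17 / 100)" by simp
  also have "\<dots> \<le> (\<Sum>j\<in>J. weight n j)"
    using weight_ge by (intro sum_mono) (auto simp: J_def level_set_def)
  also have "\<dots> \<le> (\<Sum>j<2 ^ n. weight n j)"
    using J weight_nonneg by (intro sum_mono2) auto
  also have "\<dots> \<le> mu ^ k * weight 0 0" using total_weight[of n] by (simp add: n_def)
  finally have "real (card J) \<le> weight 0 0 / (17 / 100) * mu ^ k" by (simp add: mult.commute)
  moreover have "(1 / 2 ^ n) powr (- d_v_star) = mu ^ k"
  proof -
    have "(1 / 2 ^ n) powr (- d_v_star) = (2 powr (2 * d_v_star)) powr real k"
      unfolding inverse_two_power_powr powr_powr by (simp add: n_def mult_ac)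
    then show ?thesis using mu_pos by (simp add: two_powr_dim powr_realpow)
  qed
  moreover have "card (dyadic_cell n ` J) \<le> card J" by (rule card_image_le) fact
  ultimately have "real (card (dyadic_cell n ` J)) \<le> weight 0 0 / (17 / 100) * (1 / 2 ^ n) powr (- d_v_star)"
    by (metis of_nat_le_iff order_trans)
  moreover have "level_set f y \<subseteq> \<Union> (dyadic_cell n ` J)"
  proof
    fix x assume x: "x \<in> level_set f y"
    then have "x \<in> dyadic_cell 0 0" by (simp add: level_set_def dyadic_cell_def)
    then obtain j where "j < 2 ^ (0 + n)" "x \<in> dyadic_cell (0 + n) j"
      using descendant_excess[of 0 0 x n] by auto
    then show "x \<in> \<Union> (dyadic_cell n ` J)" using x by (auto simp: J_def)
  qed
  moreover have "bounded (dyadic_cell n j) \<and> diameter (dyadic_cell n j) \<le> 1 / 2 ^ n" for j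
    by (simp add: dyadic_cell_def diameter_closed_interval divide_right_mono field_simps)
  ultimately show "\<exists>F. finite F \<and> level_set f y \<subseteq> \<Union> F \<and>
      (\<forall>U\<in>F. bounded U \<and> diameter U \<le> 1 / 2 ^ (2 * k)) \<and>
      real (card F) \<le> weight 0 0 / (17 / 100) * (1 / 2 ^ (2 * k)) powr (- d_v_star)"
    using J(1) unfolding n_def[symmetric] by (intro exI[of _ "dyadic_cell n ` J"]) auto
qed simp_all

end

text \<open>
  The sign of a given function on a cell is read off at the left end of the cell.
\<close>

theorem dim_level_set_upper:
  assumes "f \<in> T_v"
  shows "hausdorff_dim (level_set f y) \<le> ereal d_v_star"
proof -
  obtain \<omega> :: "nat \<Rightarrow> real \<Rightarrow> real" where
    sign: "\<forall>n. \<forall>x\<in>{0..1}. \<omega> n x \<in> {-1, 1}" and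
    const: "\<forall>n. \<forall>j<2 ^ n. \<omega> n constant_on {real j / 2 ^ n ..< (real j + 1) / 2 ^ n}" and
    series: "\<forall>x\<in>{0..1}. (\<lambda>n. \<omega> n x / 2 ^ n * phi (2 ^ n * x)) sums f x"
    using assms unfolding T_v_def by blast
  define \<tau> :: "nat \<Rightarrow> nat \<Rightarrow> int \<times> real \<Rightarrow> int" where
    "\<tau> n j p = (if \<omega> n (real j / 2 ^ n) = 1 then 1 else -1)" for n j p
  interpret tent_series \<tau> y \<omega> f
  proof
    fix n j x
    assume j: "j < 2 ^ n" and x: "x \<in> {real j / 2 ^ n ..< (real j + 1) / 2 ^ n}"
    have left: "real j / 2 ^ n \<in> {real j / 2 ^ n ..< (real j + 1) / 2 ^ n}"
      by (simp add: divide_strict_right_mono)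
    have "real j < 2 ^ n" using j by (metis of_nat_less_iff of_nat_numeral of_nat_power)
    then have "real j / 2 ^ n \<in> {0..1}" by simp
    then have "\<omega> n (real j / 2 ^ n) \<in> {-1, 1}" using sign by blast
    moreover have "\<omega> n x = \<omega> n (real j / 2 ^ n)"
      using const j x left unfolding constant_on_def by metis
    ultimately show "\<omega> n x = of_int (\<tau> n j (chord \<tau> y n j))" by (auto simp: \<tau>_def)
  qed (use sign series in \<open>auto simp: \<tau>_def\<close>)
  show ?thesis by (rule dim_level_set_le)
qed

section \<open>An extremal function\<close>

text \<open>
  Each tent is added downwards if the chord is above the level at its centre, and upwards otherwise. On
  the orbit below, this is the choice for which the potential inequality is an equality.
\<close>

definition towards_level :: "nat \<Rightarrow> nat \<Rightarrow> int \<times> real \<Rightarrow> int" where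
  "towards_level n j p = (if 0 \<le> snd p then -1 else 1)"

text \<open>
  The absolute values of slope and centre value of the cells that keep meeting the level \<open>-8/17\<close>. In terms
  of the distance \<open>d\<close> of the level from the nearer end of the chord these are the states \<open>(0, -8/17)\<close>,
  \<open>(0, -2/17)\<close>, \<open>(1, 1/17)\<close>, \<open>(1, 4/17)\<close>, \<open>(1, -4/17)\<close>, \<open>(2, 8/17)\<close>, \<open>(2, 2/17)\<close>, \<open>(2, -2/17)\<close> and \<open>(3, -1/17)\<close>.
  Over four generations \<open>(0, -8/17)\<close> produces six copies each of itself and of \<open>(2, 8/17)\<close>, while \<open>(2, 8/17)\<close>
  produces four and three. The leading eigenvalue of this matrix, with trace \<open>9\<close> and determinant \<open>-6\<close>,
  is \<open>alpha\<close>.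
\<close>

definition orbit :: "(int \<times> real) set" where
  "orbit = {(0, 8 / 17), (0, 2 / 17), (1, 15 / 34), (1, 9 / 34), (1, 25 / 34),
     (2, 9 / 17), (2, 15 / 17), (2, 19 / 17), (3, 53 / 34)}"

lemma cell_pot_folded: "cell_pot s c = cell_pot \<bar>s\<bar> \<bar>c\<bar>"
  using pot_sym[of "nat \<bar>s\<bar>" "\<bar>of_int s\<bar> / 2 - c"]
  by (auto simp: cell_pot_def abs_if split: if_splits)

lemma pot1_values:
  "pot1 (1 / 17) = 3 / mu" "pot1 (4 / 17) = 1" "pot1 (- 4 / 17) = 6 / mu ^ 2"
  "pot1 (16 / 17) = 3 / mu"
  by (simp_all add: pot1_def min_def)

text \<open>
  The last four values belong to the children that lose contact with the level.
\<close>

lemma orbit_values: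
  "cell_pot 0 (8 / 17) = 6 / mu" "cell_pot 0 (2 / 17) = 2"
  "cell_pot 1 (15 / 34) = 3 / mu" "cell_pot 1 (9 / 34) = 1" "cell_pot 1 (25 / 34) = 6 / mu ^ 2"
  "cell_pot 2 (9 / 17) = 3 / mu + 6 / mu ^ 2 / mu" "cell_pot 2 (15 / 17) = 1" "cell_pot 2 (19 / 17) = 6 / mu ^ 2"
  "cell_pot 3 (53 / 34) = 6 / mu ^ 2 / mu"
  "cell_pot 2 (25 / 17) = 0" "cell_pot 3 (77 / 34) = 0" "cell_pot 3 (93 / 34) = 0" "cell_pot 4 (70 / 17) = 0"
  using pot1_values
  by (simp_all add: cell_pot_def pot_simps pot3_eq_0 pot1_eq_0 pot3_neg pot_large)

text \<open>
  Bending towards the level keeps the flatter child in the orbit, and the steeper one in the orbit or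
  out of reach. The equality of potentials reduces to the equation for \<open>mu\<close> in the state \<open>(1, 9/34)\<close>.
\<close>

lemma orbit_step:
  assumes "(n, x) \<in> orbit" "n \<noteq> 0"
  shows "(n - 1, \<bar>2 * x - (of_int n + 1) / 2\<bar>) \<in> orbit" (is ?A)
    and "(n + 1, 2 * x + (of_int n - 1) / 2) \<in> orbit \<or> cell_pot (n + 1) (2 * x + (of_int n - 1) / 2) = 0" (is ?B)
    and "cell_pot (n - 1) \<bar>2 * x - (of_int n + 1) / 2\<bar> + cell_pot (n + 1) (2 * x + (of_int n - 1) / 2)
      = (if even n then 1 else mu) * cell_pot n x" (is ?C)
proof -
  have mu3: "mu * (3 / mu) = 3" "mu * (6 / mu ^ 2) = 6 / mu" "mu * (6 / mu ^ 2 / mu) = 6 / mu ^ 2"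
    "9 / mu + 6 / (mu ^ 2 * mu) = mu" "mu * 6 / mu ^ 2 = 6 / mu" "mu \<noteq> 0"
    using mu_pos mu_cubic by (auto simp: power2_eq_square)
  have "?A \<and> ?B \<and> ?C"
    using assms unfolding orbit_def
    by (elim insertE emptyE Pair_inject; hypsubst; simp add: orbit_values mu3)
  then show ?A ?B ?C by auto
qed

lemma orbit_root_step:
  assumes "(0, x) \<in> orbit"
  shows "(1, \<bar>2 * x - 1 / 2\<bar>) \<in> orbit"
    and "2 * cell_pot 1 \<bar>2 * x - 1 / 2\<bar> = cell_pot 0 x"
proof -
  have "(1, \<bar>2 * x - 1 / 2\<bar>) \<in> orbit \<and> 2 * cell_pot 1 \<bar>2 * x - 1 / 2\<bar> = cell_pot 0 x"
    using assms unfolding orbit_def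
    by (elim insertE emptyE Pair_inject; (hypsubst | simp only: zero_neq_one zero_neq_numeral); simp add: orbit_values)
  then show "(1, \<bar>2 * x - 1 / 2\<bar>) \<in> orbit" "2 * cell_pot 1 \<bar>2 * x - 1 / 2\<bar> = cell_pot 0 x" by auto
qed

lemma orbit_children:
  assumes orb: "(\<bar>s\<bar>, \<bar>c\<bar>) \<in> orbit" and t: "t = (if 0 \<le> c then -1 else 1)"
  defines "l \<equiv> 2 * c + (of_int t - of_int s) / 2" and "r \<equiv> 2 * c + (of_int t + of_int s) / 2"
  shows "(\<bar>s + t\<bar>, \<bar>l\<bar>) \<in> orbit \<or> cell_pot (s + t) l = 0"
    and "(\<bar>s - t\<bar>, \<bar>r\<bar>) \<in> orbit \<or> cell_pot (s - t) r = 0"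
    and "cell_pot (s + t) l + cell_pot (s - t) r = (if even s then 1 else mu) * cell_pot s c"
proof -
  define n x where "n = \<bar>s\<bar>" and "x = \<bar>c\<bar>"
  have "(\<bar>s + t\<bar>, \<bar>l\<bar>) \<in> orbit \<or> cell_pot \<bar>s + t\<bar> \<bar>l\<bar> = 0" (is ?L)
    and "(\<bar>s - t\<bar>, \<bar>r\<bar>) \<in> orbit \<or> cell_pot \<bar>s - t\<bar> \<bar>r\<bar> = 0" (is ?R)
    and "cell_pot \<bar>s + t\<bar> \<bar>l\<bar> + cell_pot \<bar>s - t\<bar> \<bar>r\<bar> = (if even n then 1 else mu) * cell_pot n x" (is ?S)
  proof -
    have "?L \<and> ?R \<and> ?S"
    proof (cases "s = 0")
      case True
      then have eqs: "\<bar>s + t\<bar> = 1" "\<bar>s - t\<bar> = 1" "\<bar>l\<bar> = \<bar>2 * x - 1 / 2\<bar>" "\<bar>r\<bar> = \<bar>2 * x - 1 / 2\<bar>"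
        by (auto simp: t l_def r_def x_def)
      have "n = 0" "(0, x) \<in> orbit" using orb True by (auto simp: n_def x_def)
      then show ?thesis unfolding eqs using orbit_root_step[of x] by simp
    next
      case False
      have "(\<bar>s + t\<bar> = n - 1 \<and> \<bar>l\<bar> = \<bar>2 * x - (of_int n + 1) / 2\<bar> \<and>
          \<bar>s - t\<bar> = n + 1 \<and> \<bar>r\<bar> = 2 * x + (of_int n - 1) / 2) \<or>
         (\<bar>s - t\<bar> = n - 1 \<and> \<bar>r\<bar> = \<bar>2 * x - (of_int n + 1) / 2\<bar> \<and>
          \<bar>s + t\<bar> = n + 1 \<and> \<bar>l\<bar> = 2 * x + (of_int n - 1) / 2)"
      proof -
        have arith: "\<bar>s + t\<bar> = n - 1 \<and> \<bar>s - t\<bar> = n + 1" if "s \<le> - 1 \<and> t = 1 \<or> 1 \<le> s \<and> t = - 1"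
          using that by (auto simp: n_def)
        have arith': "\<bar>s - t\<bar> = n - 1 \<and> \<bar>s + t\<bar> = n + 1" if "s \<le> - 1 \<and> t = - 1 \<or> 1 \<le> s \<and> t = 1"
          using that by (auto simp: n_def)
        have n: "of_int n \<ge> (1 :: real)" using False by (simp add: n_def)
        consider "1 \<le> s" "0 \<le> c" | "1 \<le> s" "c < 0" | "s \<le> - 1" "0 \<le> c" | "s \<le> - 1" "c < 0"
          using False by linarith
        then show ?thesis
        proof cases
          case 1
          then have "l = 2 * x - (of_int n + 1) / 2" "r = 2 * x + (of_int n - 1) / 2" "0 \<le> r"
            using n by (simp_all add: l_def r_def t n_def x_def field_simps)
          then show ?thesis using 1 arith by (simp add: t)
        next
          case 2
          then have "l = - (2 * x + (of_int n - 1) / 2)" "r = - (2 * x - (of_int n + 1) / 2)" "l \<le> 0"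
            using n by (simp_all add: l_def r_def t n_def x_def field_simps)
          then show ?thesis using 2 arith' unfolding abs_minus_cancel by (simp add: t)
        next
          case 3
          then have "l = 2 * x + (of_int n - 1) / 2" "r = 2 * x - (of_int n + 1) / 2" "0 \<le> l"
            using n by (simp_all add: l_def r_def t n_def x_def field_simps)
          then show ?thesis using 3 arith' by (simp add: t)
        next
          case 4
          then have "l = - (2 * x - (of_int n + 1) / 2)" "r = - (2 * x + (of_int n - 1) / 2)" "r \<le> 0"
            using n by (simp_all add: l_def r_def t n_def x_def field_simps)
          then show ?thesis using 4 arith unfolding abs_minus_cancel by (simp add: t)
        qed
      qed
      moreover have "n \<noteq> 0" "(n, x) \<in> orbit" using False orb by (auto simp: n_def x_def)
      ultimately show ?thesis using orbit_step[of n x] by (elim disjE) (simp_all add: add.commute)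
    qed
    then show ?L ?R ?S by auto
  qed
  moreover have even_abs: "even \<bar>s\<bar> = even s" by simp
  ultimately show "(\<bar>s + t\<bar>, \<bar>l\<bar>) \<in> orbit \<or> cell_pot (s + t) l = 0"
    "(\<bar>s - t\<bar>, \<bar>r\<bar>) \<in> orbit \<or> cell_pot (s - t) r = 0"
    "cell_pot (s + t) l + cell_pot (s - t) r = (if even s then 1 else mu) * cell_pot s c"
    unfolding cell_pot_folded[of "s + t" l] cell_pot_folded[of "s - t" r] cell_pot_folded[of s c]
    by (simp_all only: n_def x_def even_abs)
qed

definition extremal_level :: real where
  "extremal_level = - (8 / 17)"

definition extremal_sign :: "nat \<Rightarrow> real \<Rightarrow> real" where
  "extremal_sign n x = (let j = nat \<lfloor>2 ^ n * x\<rfloor> in of_int (towards_level n j (chord towards_level extremal_level n j)))"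

definition extremal_fun :: "real \<Rightarrow> real" where
  "extremal_fun x = (\<Sum>n. extremal_sign n x / 2 ^ n * phi (2 ^ n * x))"

text \<open>
  The constant sign on half-open cells makes the function a member of the class.
\<close>

lemma extremal_sign_cell:
  assumes "x \<in> {real j / 2 ^ n ..< (real j + 1) / 2 ^ n}"
  shows "extremal_sign n x = of_int (towards_level n j (chord towards_level extremal_level n j))"
proof -
  have "\<lfloor>2 ^ n * x\<rfloor> = int j"
    using assms by (intro floor_unique) (auto simp: field_simps)
  then show ?thesis by (simp add: extremal_sign_def)
qed

lemma extremal_fun_series: "(\<lambda>n. extremal_sign n x / 2 ^ n * phi (2 ^ n * x)) sums extremal_fun x"
  unfolding extremal_fun_def
proof (rule summable_sums, rule summable_comparison_test)
  show "summable (\<lambda>n. (1 / 2 :: real) ^ n)" by (simp add: summable_geometric)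
  have "norm (extremal_sign n x / 2 ^ n * phi (2 ^ n * x)) \<le> (1 / 2) ^ n" for n
  proof -
    have "\<bar>extremal_sign n x\<bar> = 1" by (simp add: extremal_sign_def towards_level_def Let_def)
    then have "norm (extremal_sign n x / 2 ^ n * phi (2 ^ n * x)) = phi (2 ^ n * x) / 2 ^ n"
      using phi_bounds(1)[of "2 ^ n * x"] by (simp add: abs_mult)
    also have "\<dots> \<le> 1 / 2 ^ n" using phi_bounds(2)[of "2 ^ n * x"] by (intro divide_right_mono) auto
    finally show ?thesis by (simp add: power_one_over)
  qed
  then show "\<exists>N. \<forall>n\<ge>N. norm (extremal_sign n x / 2 ^ n * phi (2 ^ n * x)) \<le> (1 / 2) ^ n" by blast
qed

interpretation extremal: tent_series towards_level extremal_level extremal_sign extremal_fun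
  using extremal_sign_cell extremal_fun_series by unfold_locales (auto simp: towards_level_def extremal_sign_def Let_def)

lemma extremal_fun_in_T_v: "extremal_fun \<in> T_v"
  unfolding T_v_def
proof (intro CollectI exI[of _ extremal_sign] conjI allI impI ballI)
  show "extremal_sign n constant_on {real j / 2 ^ n ..< (real j + 1) / 2 ^ n}" for n j
    unfolding constant_on_def using extremal_sign_cell[of _ j n] by blast
qed (use extremal.\<omega>_sign extremal.series in auto)

lemma extremal_root: "extremal.slope 0 j = 0" "extremal.centre 0 j = 8 / 17"
  unfolding extremal.root by (simp_all add: extremal_level_def)

text \<open>
  Starting in the orbit, a cell remains in it or reaches potential \<open>0\<close>, which is passed on to all
  descendants by the potential inequality.
\<close>

lemma extremal_invariant:
  "(\<bar>extremal.slope n j\<bar>, \<bar>extremal.centre n j\<bar>) \<in> orbit \<or> extremal.weight n j = 0"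
proof (induction n arbitrary: j)
  case 0
  then show ?case by (simp add: extremal_root orbit_def)
next
  case (Suc n)
  define p where "p = j div 2"
  have j: "j = 2 * p \<or> j = 2 * p + 1" unfolding p_def by presburger
  from Suc[of p] show ?case
  proof
    assume orb: "(\<bar>extremal.slope n p\<bar>, \<bar>extremal.centre n p\<bar>) \<in> orbit"
    have bend: "extremal.bend n p = (if 0 \<le> extremal.centre n p then -1 else 1)"
      by (simp add: extremal.bend_def towards_level_def extremal.centre_def)
    from j show ?case
      using orbit_children(1,2)[OF orb bend] unfolding extremal.weight_def by (auto simp only: extremal.left extremal.right)
  next
    assume "extremal.weight n p = 0"
    then have "extremal.weight (Suc n) (2 * p) + extremal.weight (Suc n) (2 * p + 1) \<le> 0"
      using extremal.weight_children[of n p] by simp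
    then have "extremal.weight (Suc n) (2 * p) = 0" "extremal.weight (Suc n) (2 * p + 1) = 0"
      using extremal.weight_nonneg[of "Suc n" "2 * p"] extremal.weight_nonneg[of "Suc n" "2 * p + 1"] by linarith+
    then show ?case using j by auto
  qed
qed

lemma extremal_weight_children:
  "extremal.weight (Suc n) (2 * j) + extremal.weight (Suc n) (2 * j + 1) = (if even n then 1 else mu) * extremal.weight n j"
  using extremal_invariant[of n j]
proof
  assume orb: "(\<bar>extremal.slope n j\<bar>, \<bar>extremal.centre n j\<bar>) \<in> orbit"
  have bend: "extremal.bend n j = (if 0 \<le> extremal.centre n j then -1 else 1)"
    by (simp add: extremal.bend_def towards_level_def extremal.centre_def)
  show ?thesis
    unfolding extremal.weight_def extremal.left extremal.right extremal.even_slope[symmetric, of n j]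
    by (rule orbit_children(3)[OF orb bend])
next
  assume "extremal.weight n j = 0"
  then show ?thesis
    using extremal.weight_children[of n j] extremal.weight_nonneg[of "Suc n" "2 * j"] extremal.weight_nonneg[of "Suc n" "2 * j + 1"]
    by auto
qed

text \<open>
  The exponent counts the odd generations passed so far, which are the ones at which the total
  potential is multiplied by \<open>mu\<close>.
\<close>

definition extremal_mass :: "nat \<Rightarrow> nat \<Rightarrow> real" where
  "extremal_mass n j = extremal.weight n j / mu ^ (n div 2)"

interpretation extremal_mass: dyadic_mass extremal_mass
proof
  fix n j
  show "0 \<le> extremal_mass n j" using mu_pos by (simp add: extremal_mass_def extremal.weight_nonneg)
  have "extremal_mass (Suc n) (2 * j) + extremal_mass (Suc n) (2 * j + 1) =
      (if even n then 1 else mu) * extremal.weight n j / mu ^ (Suc n div 2)"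
    unfolding extremal_mass_def extremal_weight_children[symmetric] by (simp add: add_divide_distrib)
  also have "\<dots> = extremal_mass n j" using mu_pos by (simp add: extremal_mass_def)
  finally show "extremal_mass n j = extremal_mass (Suc n) (2 * j) + extremal_mass (Suc n) (2 * j + 1)" by simp
qed

text \<open>
  On the cells of the orbit slope and centre value are bounded, so the partial sums converge to the level.
\<close>

lemma extremal_support: "extremal_mass.support \<subseteq> level_set extremal_fun extremal_level"
proof
  fix x assume x: "x \<in> extremal_mass.support"
  have cell: "\<exists>j<2 ^ n. 0 < extremal_mass n j \<and> x \<in> dyadic_cell n j" for n
    using x by (auto simp: extremal_mass.support_def)
  have unit: "x \<in> {0..1}" using cell[of 0] extremal.dyadic_cell_unit by blast
  have close: "\<bar>extremal.partial n x - extremal_level\<bar> \<le> 4 * (1 / 2) ^ n" for n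
  proof -
    obtain j where j: "j < 2 ^ n" "0 < extremal_mass n j" "x \<in> dyadic_cell n j" using cell by blast
    define u where "u = 2 ^ n * x - real j - 1 / 2"
    have u: "\<bar>u\<bar> \<le> 1 / 2" using j(3) by (auto simp: u_def dyadic_cell_def field_simps abs_le_iff)
    have "(\<bar>extremal.slope n j\<bar>, \<bar>extremal.centre n j\<bar>) \<in> orbit"
      using extremal_invariant[of n j] j(2) by (auto simp: extremal_mass_def)
    then have "\<bar>extremal.slope n j\<bar> \<le> 3" and c: "\<bar>extremal.centre n j\<bar> \<le> 2" by (auto simp: orbit_def)
    then have s: "\<bar>of_int (extremal.slope n j) :: real\<bar> \<le> 3" by linarith
    have "\<bar>of_int (extremal.slope n j) * u\<bar> \<le> 3 * (1 / 2)"
      unfolding abs_mult by (intro mult_mono s u) auto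
    then have "\<bar>2 ^ n * (extremal.partial n x - extremal_level)\<bar> \<le> 4"
      using extremal.partial_on_cell[OF j(1,3)] c unfolding u_def[symmetric] by linarith
    then show ?thesis by (simp add: abs_mult power_one_over pos_le_divide_eq mult.commute)
  qed
  have "(\<lambda>n. 4 * (1 / 2 :: real) ^ n) \<longlonglongrightarrow> 4 * 0"
    by (intro tendsto_mult_left LIMSEQ_power_zero) simp
  then have "(\<lambda>n. extremal.partial n x - extremal_level) \<longlonglongrightarrow> 0"
    using close Lim_null_comparison[of "\<lambda>n. extremal.partial n x - extremal_level" "\<lambda>n. 4 * (1 / 2) ^ n" sequentially]
    unfolding real_norm_def mult_zero_right by (simp only: eventually_True simp_thms)
  then have "(\<lambda>n. extremal.partial n x) \<longlonglongrightarrow> extremal_level" using LIM_zero_cancel by fastforce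
  moreover have "(\<lambda>n. extremal.partial n x) \<longlonglongrightarrow> extremal_fun x"
    using extremal.series[OF unit] by (simp add: sums_def extremal.partial_def)
  ultimately have "extremal_fun x = extremal_level" by (rule LIMSEQ_unique[rotated])
  then show "x \<in> level_set extremal_fun extremal_level" using unit by (simp add: level_set_def)
qed

lemma extremal_mass_le: "extremal_mass n j \<le> 2 * mu * (1 / 2 ^ n) powr d_v_star"
proof -
  have "pot k e \<le> 2" for k e
  proof -
    define d where "d = min e (real k - e)"
    have "pot1 (2 * d) + pot3 (2 * d - 1) \<le> 2" "pot3 e \<le> 2" "pot1 e \<le> 2" "pot1 (2 * \<bar>e\<bar>) \<le> 1"
      using pot1_bounds(2)[of "2 * d"] pot3_le[of "2 * d - 1"] pot3_le[of e] pot1_bounds(2)[of e]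
        pot1_bounds(2)[of "2 * \<bar>e\<bar>"] by linarith+
    then show ?thesis unfolding pot_def Let_def d_def[symmetric] by simp
  qed
  then have "extremal_mass n j \<le> 2 / mu ^ (n div 2)"
    using mu_pos by (simp add: extremal_mass_def extremal.weight_def cell_pot_def divide_right_mono)
  also have "\<dots> = 2 * mu powr (- real (n div 2))"
    using mu_pos by (simp add: powr_minus_divide powr_realpow)
  also have "\<dots> \<le> 2 * mu powr (1 - real n / 2)"
    using mu_bounds by (intro mult_left_mono powr_mono) (auto simp: real_of_nat_div)
  also have "\<dots> = 2 * mu * mu powr (- (real n / 2))"
    using mu_pos by (simp add: powr_diff powr_minus_divide)
  also have "mu powr (- (real n / 2)) = (1 / 2 ^ n) powr d_v_star"
    unfolding inverse_two_power_powr two_powr_dim[symmetric] powr_powr by (simp add: mult.commute)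
  finally show ?thesis .
qed

theorem dim_extremal: "hausdorff_dim (level_set extremal_fun extremal_level) = ereal d_v_star"
proof (rule antisym)
  show "hausdorff_dim (level_set extremal_fun extremal_level) \<le> ereal d_v_star"
    by (rule extremal.dim_level_set_le)
  have "hausdorff_premeasure 1 d_v_star extremal_mass.support \<noteq> 0"
  proof (rule extremal_mass.mass_distribution[OF extremal_mass.compact_support _ extremal_mass.support_meets extremal_mass_le d_v_star_pos])
    show "0 < extremal_mass 0 0"
      using mu_pos by (simp add: extremal_mass_def extremal.weight_def extremal_root orbit_values)
  qed
  then have "hausdorff_premeasure 1 d_v_star (level_set extremal_fun extremal_level) \<noteq> 0"
    using hausdorff_premeasure_mono[OF extremal_support, of 1 d_v_star] by auto
  then show "ereal d_v_star \<le> hausdorff_dim (level_set extremal_fun extremal_level)"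
    by (rule hausdorff_dim_ge)
qed

theorem theorem1p3:
  shows "(\<exists>f\<in>T_v. \<exists>y. hausdorff_dim (level_set f y) = ereal d_v_star) \<and>
         (\<forall>f\<in>T_v. \<forall>y. hausdorff_dim (level_set f y) \<le> ereal d_v_star)"
  using extremal_fun_in_T_v dim_extremal dim_level_set_upper by blast

end
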